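(* Let $p\ge 1$ be an integer and let $t\in\mathbb{C}$, $t\neq 0$. Put $$c=13+6t+6t^{-1},\qquad h=-\frac{(p-1+t)\left(t^{-1}(p+1)+3\right)}{4},$$ and let $V=V(h,c)$ be the Verma module over the Virasoro algebra with generating vector $v$. Consider the element of $U(L_1)$ $$S_{2,p}(t)=\sum_{\substack{(i_1,\dots,i_s)\\ i_1+\dots+i_s=2p}} f_p(i_1,\dots,i_s)\,e_{i_1}e_{i_2}\cdots e_{i_s},$$ where the sum is over all $s\ge 1$ and all finite sequences $(i_1,\dots,i_s)$ of positive integers with sum $2p$ (no ordering restriction, i.e. over all compositions of $2p$), and the coefficients are the rational functions of $t$ $$f_p(i_1,\dots,i_s)=\frac{(2p-1)!^2\,(2t)^{s-2p}\,\prod\limits_{r=1}^{2p-1}(p-t-r)\,\prod\limits_{m=1}^{s}\Bigl(i_m(2t+1)+2\bigl(p-t-\sum\limits_{n=1}^{m} i_n\bigr)\Bigr)}{\prod\limits_{l=0}^{2p-1}(2p-1-2l)\,\prod\limits_{l=1}^{s-1}\Bigl(\bigl(\sum\limits_{n=1}^{l} i_n\bigr)\bigl(2p-\sum\limits_{n=1}^{l} i_n\bigr)\bigl(p-t-\sum\limits_{n=1}^{l} i_n\bigr)\Bigr)}.$$ Then $S_{2,p}(t)v$ is a singular vector of $V$; that is, it is a nonzero vector and $$e_{-k}\,S_{2,p}(t)\,v=0\qquad\text{for all } k\in\mathbb{N},\ k\ge 1.$$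
   Context: The Virasoro algebra $\mathrm{Vir}$ is the complex Lie algebra with basis $\{z,\ e_i,\ i\in\mathbb{Z}\}$ and brackets $$[e_i,z]=0,\qquad [e_i,e_j]=(j-i)e_{i+j}+\frac{j^3-j}{12}\,\delta_{-i,j}\,z .$$ $L_1$ is the Lie subalgebra spanned by $e_i$, $i\ge 1$, and $U(L_1)$ is its universal enveloping algebra. For $h,c\in\mathbb{C}$, the Verma module $V(h,c)$ is the $\mathrm{Vir}$-module generated by a vector $v$ with $zv=cv$, $e_0v=hv$, $e_iv=0$ for all $i<0$, which is free as a $U(L_1)$-module on the generator $v$; equivalently it has basis $v$ and $e_{i_1}\cdots e_{i_s}v$ with $i_1\ge i_2\ge\dots\ge i_s\ge 1$, $s\ge 1$. A vector $w\in V(h,c)$ is called singular if $w\ne 0$ and $e_iw=0$ for all $i<0$. Empty products equal $1$. The coefficients $f_p(i_1,\dots,i_s)$ are understood as rational functions of $t$, i.e. after cancellation: the partial sums $\sum_{n=1}^{l}i_n$, $1\le l\le s-1$, are distinct elements of $\{1,\dots,2p-1\}$, so every factor $p-t-\sum_{n=1}^{l}i_n$ in the denominator cancels with a factor of $\prod_{r=1}^{2p-1}(p-t-r)$, and the coefficient is defined for every $t\neq 0$. *)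

theory Defs
  imports
    "HOL-Library.Poly_Mapping"
    "HOL-Algebra.QuotRing"
    "HOL-Computational_Algebra.Computational_Algebra"
    "HOL-Computational_Algebra.Field_as_Ring"
begin

section \<open>Lie algebras and their modules over the complex numbers\<close>

locale lie_algebra = vector_space scale
  for scale :: "complex \<Rightarrow> 'g::ab_group_add \<Rightarrow> 'g" +
  fixes bracket :: "'g \<Rightarrow> 'g \<Rightarrow> 'g"
  assumes bracket_add_left: "bracket (x + y) w = bracket x w + bracket y w"
    and bracket_add_right: "bracket w (x + y) = bracket w x + bracket w y"
    and bracket_scale_left: "bracket (scale a x) y = scale a (bracket x y)"
    and bracket_scale_right: "bracket x (scale a y) = scale a (bracket x y)"
    and bracket_self: "bracket x x = 0"
    and jacobi: "bracket x (bracket y w) + bracket y (bracket w x) + bracket w (bracket x y) = 0"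

definition (in lie_algebra) lie_subalgebra :: "'g set \<Rightarrow> bool" where
  "lie_subalgebra L \<longleftrightarrow> subspace L \<and> (\<forall>x\<in>L. \<forall>y\<in>L. bracket x y \<in> L)"

locale lie_module = lie_algebra scale bracket + V: vector_space vscale
  for scale :: "complex \<Rightarrow> 'g::ab_group_add \<Rightarrow> 'g"
    and bracket :: "'g \<Rightarrow> 'g \<Rightarrow> 'g"
    and vscale :: "complex \<Rightarrow> 'v::ab_group_add \<Rightarrow> 'v" +
  fixes act :: "'g \<Rightarrow> 'v \<Rightarrow> 'v"
  assumes act_add_left: "act (x + y) u = act x u + act y u"
    and act_scale_left: "act (scale a x) u = vscale a (act x u)"
    and act_add_right: "act x (u + w) = act x u + act x w"
    and act_scale_right: "act x (vscale a u) = vscale a (act x u)"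
    and act_bracket: "act (bracket x y) u = act x (act y u) - act y (act x u)"


section \<open>Universal enveloping algebras\<close>

datatype 'a free_monoid = FM (letters: "'a list")

instantiation free_monoid :: (type) monoid_add
begin

definition zero_free_monoid :: "'a free_monoid" where
  "0 = FM []"

definition plus_free_monoid :: "'a free_monoid \<Rightarrow> 'a free_monoid \<Rightarrow> 'a free_monoid" where
  "u + w = FM (letters u @ letters w)"

instance
  by standard (auto simp: zero_free_monoid_def plus_free_monoid_def)

end

lemma letters_zero [simp]: "letters 0 = []"
  by (simp add: zero_free_monoid_def)

lemma letters_plus [simp]: "letters (u + w) = letters u @ letters w"
  by (simp add: plus_free_monoid_def)

text \<open>
  The convolution product of \<^typ>\<open>'a free_monoid \<Rightarrow>\<^sub>0 complex\<close> is that of the monoid algebra, so this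
  is the free associative unital algebra on the set \<^term>\<open>L\<close>; the monomial with coefficient
  \<^term>\<open>a\<close> and letters \<^term>\<open>xs\<close> is \<^term>\<open>Poly_Mapping.single (FM xs) a\<close>.
\<close>

definition free_algebra :: "'g set \<Rightarrow> ('g free_monoid \<Rightarrow>\<^sub>0 complex) ring" where
  "free_algebra L =
    \<lparr>carrier = {p. \<forall>w\<in>Poly_Mapping.keys p. set (letters w) \<subseteq> L},
     monoid.mult = (*), one = 1, zero = 0, add = (+)\<rparr>"

definition free_gen :: "'g \<Rightarrow> ('g free_monoid \<Rightarrow>\<^sub>0 complex)" where
  "free_gen x = Poly_Mapping.single (FM [x]) 1"

text \<open>
  The first two families of relations make the generators depend linearly on their label, so
  that the quotient by them alone is the tensor algebra of \<^term>\<open>L\<close>.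
\<close>

definition uea_relations ::
  "(complex \<Rightarrow> 'g::ab_group_add \<Rightarrow> 'g) \<Rightarrow> ('g \<Rightarrow> 'g \<Rightarrow> 'g) \<Rightarrow> 'g set
    \<Rightarrow> ('g free_monoid \<Rightarrow>\<^sub>0 complex) set" where
  "uea_relations scale bracket L =
     {free_gen (x + y) - free_gen x - free_gen y | x y. x \<in> L \<and> y \<in> L}
   \<union> {free_gen (scale a x) - Poly_Mapping.single 0 a * free_gen x | a x. x \<in> L}
   \<union> {free_gen x * free_gen y - free_gen y * free_gen x - free_gen (bracket x y)
        | x y. x \<in> L \<and> y \<in> L}"

definition uea_ideal ::
  "(complex \<Rightarrow> 'g::ab_group_add \<Rightarrow> 'g) \<Rightarrow> ('g \<Rightarrow> 'g \<Rightarrow> 'g) \<Rightarrow> 'g set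
    \<Rightarrow> ('g free_monoid \<Rightarrow>\<^sub>0 complex) set" where
  "uea_ideal scale bracket L = genideal (free_algebra L) (uea_relations scale bracket L)"

definition uea ::
  "(complex \<Rightarrow> 'g::ab_group_add \<Rightarrow> 'g) \<Rightarrow> ('g \<Rightarrow> 'g \<Rightarrow> 'g) \<Rightarrow> 'g set
    \<Rightarrow> (('g free_monoid \<Rightarrow>\<^sub>0 complex) set) ring" where
  "uea scale bracket L = free_algebra L Quot uea_ideal scale bracket L"

definition uea_class ::
  "(complex \<Rightarrow> 'g::ab_group_add \<Rightarrow> 'g) \<Rightarrow> ('g \<Rightarrow> 'g \<Rightarrow> 'g) \<Rightarrow> 'g set
    \<Rightarrow> ('g free_monoid \<Rightarrow>\<^sub>0 complex) \<Rightarrow> ('g free_monoid \<Rightarrow>\<^sub>0 complex) set" where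
  "uea_class scale bracket L q = uea_ideal scale bracket L +>\<^bsub>free_algebra L\<^esub> q"

definition free_act ::
  "(complex \<Rightarrow> 'v::ab_group_add \<Rightarrow> 'v) \<Rightarrow> ('g \<Rightarrow> 'v \<Rightarrow> 'v)
    \<Rightarrow> ('g free_monoid \<Rightarrow>\<^sub>0 complex) \<Rightarrow> 'v \<Rightarrow> 'v" where
  "free_act vscale act q u =
     (\<Sum>w\<in>Poly_Mapping.keys q. vscale (Poly_Mapping.lookup q w) (foldr act (letters w) u))"

text \<open>
  All representatives of a class act in the same way on a module (lemma \<open>uea_act_class\<close> below).
\<close>

definition uea_act ::
  "(complex \<Rightarrow> 'v::ab_group_add \<Rightarrow> 'v) \<Rightarrow> ('g \<Rightarrow> 'v \<Rightarrow> 'v)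
    \<Rightarrow> ('g free_monoid \<Rightarrow>\<^sub>0 complex) set \<Rightarrow> 'v \<Rightarrow> 'v" where
  "uea_act vscale act U u = the_elem ((\<lambda>q. free_act vscale act q u) ` U)"

lemma free_algebra_simps [simp]:
  "monoid.mult (free_algebra L) = (*)" "one (free_algebra L) = 1"
  "zero (free_algebra L) = 0" "add (free_algebra L) = (+)"
  by (simp_all add: free_algebra_def)

lemma carrier_free_algebra:
  "q \<in> carrier (free_algebra L) \<longleftrightarrow> (\<forall>w\<in>Poly_Mapping.keys q. set (letters w) \<subseteq> L)"
  by (simp add: free_algebra_def)

lemma single_in_free_algebra:
  "set xs \<subseteq> L \<Longrightarrow> Poly_Mapping.single (FM xs) a \<in> carrier (free_algebra L)"
  by (simp add: carrier_free_algebra)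

lemma ring_free_algebra: "ring (free_algebra L)"
proof (rule ringI)
  show "abelian_group (free_algebra L)"
  proof (rule abelian_groupI)
    fix x y assume "x \<in> carrier (free_algebra L)" "y \<in> carrier (free_algebra L)"
    then show "x \<oplus>\<^bsub>free_algebra L\<^esub> y \<in> carrier (free_algebra L)"
      using Poly_Mapping.keys_add[of x y] by (auto simp: carrier_free_algebra)
  next
    fix x assume "x \<in> carrier (free_algebra L)"
    then show "\<exists>y\<in>carrier (free_algebra L). y \<oplus>\<^bsub>free_algebra L\<^esub> x = \<zero>\<^bsub>free_algebra L\<^esub>"
      by (intro bexI[of _ "- x"]) (auto simp: carrier_free_algebra)
  qed (auto simp: carrier_free_algebra add_ac)
next
  show "Group.monoid (free_algebra L)"
  proof (rule monoidI)
    fix x y assume "x \<in> carrier (free_algebra L)" "y \<in> carrier (free_algebra L)"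
    then show "x \<otimes>\<^bsub>free_algebra L\<^esub> y \<in> carrier (free_algebra L)"
      using Poly_Mapping.keys_mult[of x y] by (fastforce simp: carrier_free_algebra)
  qed (auto simp: carrier_free_algebra mult.assoc)
qed (auto simp: distrib_left distrib_right)

lemma poly_mapping_eq_sum_single:
  "q = (\<Sum>w\<in>Poly_Mapping.keys q. Poly_Mapping.single w (Poly_Mapping.lookup q w))"
  by (rule poly_mapping_eqI) (auto simp: lookup_sum lookup_single when_def in_keys_iff)

context lie_module
begin

lemma foldr_act_add: "foldr act xs (u + w) = foldr act xs u + foldr act xs w"
  by (induction xs) (auto simp: act_add_right)

lemma foldr_act_scale: "foldr act xs (vscale a u) = vscale a (foldr act xs u)"
  by (induction xs) (auto simp: act_scale_right)

lemma free_act_superset: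
  assumes "finite A" "Poly_Mapping.keys q \<subseteq> A"
  shows "free_act vscale act q u =
    (\<Sum>w\<in>A. vscale (Poly_Mapping.lookup q w) (foldr act (letters w) u))"
  unfolding free_act_def
  by (rule sum.mono_neutral_left) (use assms in \<open>auto simp: in_keys_iff\<close>)

lemma free_act_add: "free_act vscale act (q + r) u = free_act vscale act q u + free_act vscale act r u"
proof -
  let ?A = "Poly_Mapping.keys q \<union> Poly_Mapping.keys r"
  have "free_act vscale act (q + r) u =
      (\<Sum>w\<in>?A. vscale (Poly_Mapping.lookup (q + r) w) (foldr act (letters w) u))"
    by (rule free_act_superset) (use Poly_Mapping.keys_add[of q r] in auto)
  also have "\<dots> = free_act vscale act q u + free_act vscale act r u"
    by (subst (1 2) free_act_superset[where A = ?A])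
       (auto simp: lookup_add V.scale_left_distrib sum.distrib)
  finally show ?thesis .
qed

lemma free_act_zero [simp]: "free_act vscale act 0 u = 0"
  by (simp add: free_act_def)

lemma free_act_minus: "free_act vscale act (q - r) u = free_act vscale act q u - free_act vscale act r u"
  using free_act_add[of "q - r" r u] by (simp add: algebra_simps)

lemma free_act_sum: "free_act vscale act (\<Sum>i\<in>I. q i) u = (\<Sum>i\<in>I. free_act vscale act (q i) u)"
  by (induction I rule: infinite_finite_induct) (auto simp: free_act_add)

lemma free_act_single:
  "free_act vscale act (Poly_Mapping.single w a) u = vscale a (foldr act (letters w) u)"
  by (simp add: free_act_def)

lemma free_act_add_right:
  "free_act vscale act q (u + w) = free_act vscale act q u + free_act vscale act q w"
  by (simp add: free_act_def foldr_act_add V.scale_right_distrib sum.distrib)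

lemma free_act_zero_right [simp]: "free_act vscale act q 0 = 0"
  using free_act_add_right[of q 0 0] by simp

lemma free_act_scale_right: "free_act vscale act q (vscale a u) = vscale a (free_act vscale act q u)"
  by (simp add: free_act_def foldr_act_scale V.scale_sum_right mult.commute)

lemma free_act_sum_right: "free_act vscale act q (\<Sum>i\<in>I. f i) = (\<Sum>i\<in>I. free_act vscale act q (f i))"
  by (induction I rule: infinite_finite_induct) (auto simp: free_act_add_right)

lemma free_act_mult_single:
  "free_act vscale act (Poly_Mapping.single w a * Poly_Mapping.single w' b) u =
   free_act vscale act (Poly_Mapping.single w a) (free_act vscale act (Poly_Mapping.single w' b) u)"
  by (simp add: mult_single free_act_single foldr_act_scale)

lemma free_act_mult: "free_act vscale act (q * r) u = free_act vscale act q (free_act vscale act r u)"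
proof -
  let ?s = "\<lambda>q w. Poly_Mapping.single w (Poly_Mapping.lookup q w)"
  have "free_act vscale act (q * r) u = free_act vscale act
      ((\<Sum>w\<in>Poly_Mapping.keys q. ?s q w) * (\<Sum>w\<in>Poly_Mapping.keys r. ?s r w)) u"
    using poly_mapping_eq_sum_single[of q] poly_mapping_eq_sum_single[of r] by simp
  also have "\<dots> = (\<Sum>w\<in>Poly_Mapping.keys q. \<Sum>w'\<in>Poly_Mapping.keys r.
      free_act vscale act (?s q w) (free_act vscale act (?s r w') u))"
    by (simp add: sum_product free_act_sum free_act_mult_single)
  also have "\<dots> = free_act vscale act (\<Sum>w\<in>Poly_Mapping.keys q. ?s q w)
      (free_act vscale act (\<Sum>w\<in>Poly_Mapping.keys r. ?s r w) u)"
    by (simp add: free_act_sum free_act_sum_right) (rule sum.swap)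
  also have "\<dots> = free_act vscale act q (free_act vscale act r u)"
    using poly_mapping_eq_sum_single[of q] poly_mapping_eq_sum_single[of r] by simp
  finally show ?thesis .
qed

lemma free_act_uea_relations:
  "q \<in> uea_relations scale bracket L \<Longrightarrow> free_act vscale act q u = 0"
  by (auto simp: uea_relations_def free_gen_def free_act_minus free_act_mult free_act_single
      act_add_left act_scale_left act_bracket)

lemma uea_relations_subset:
  assumes "lie_subalgebra L"
  shows "uea_relations scale bracket L \<subseteq> carrier (free_algebra L)"
proof -
  interpret F: ring "free_algebra L" by (rule ring_free_algebra)
  have minus: "q - r \<in> carrier (free_algebra L)"
    if "q \<in> carrier (free_algebra L)" "r \<in> carrier (free_algebra L)" for q r
    using that Poly_Mapping.keys_diff[of q r] by (auto simp: carrier_free_algebra)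
  have mult: "q * r \<in> carrier (free_algebra L)"
    if "q \<in> carrier (free_algebra L)" "r \<in> carrier (free_algebra L)" for q r
    using F.m_closed[OF that] by simp
  have gen: "free_gen x \<in> carrier (free_algebra L)" if "x \<in> L" for x
    using that by (simp add: free_gen_def single_in_free_algebra)
  have scalar: "Poly_Mapping.single 0 a \<in> carrier (free_algebra L)" for a
    by (simp add: carrier_free_algebra)
  show ?thesis
    using assms unfolding lie_subalgebra_def uea_relations_def
    by (auto intro!: minus mult gen scalar simp: subspace_add subspace_scale)
qed

lemma uea_ideal_ideal:
  assumes "lie_subalgebra L"
  shows "ideal (uea_ideal scale bracket L) (free_algebra L)"
  unfolding uea_ideal_def
  by (rule ring.genideal_ideal[OF ring_free_algebra uea_relations_subset[OF assms]])

lemma ring_uea: "lie_subalgebra L \<Longrightarrow> ring (uea scale bracket L)"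
  unfolding uea_def by (rule ideal.quotient_is_ring[OF uea_ideal_ideal])

lemma uea_class_closed:
  assumes "lie_subalgebra L" "q \<in> carrier (free_algebra L)"
  shows "uea_class scale bracket L q \<in> carrier (uea scale bracket L)"
  using assms by (auto simp: uea_class_def uea_def FactRing_def A_RCOSETS_def')

lemma free_act_uea_ideal:
  assumes "lie_subalgebra L" "q \<in> uea_ideal scale bracket L"
  shows "free_act vscale act q u = 0"
proof -
  interpret F: ring "free_algebra L" by (rule ring_free_algebra)
  let ?K = "{q \<in> carrier (free_algebra L). \<forall>u. free_act vscale act q u = 0}"
  have neg: "inv\<^bsub>add_monoid (free_algebra L)\<^esub> q = - q" if "q \<in> carrier (free_algebra L)" for q
  proof (rule group.inv_equality[OF F.a_group])
    show "- q \<in> carrier (add_monoid (free_algebra L))"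
      using that by (simp add: carrier_free_algebra)
  qed (use that in auto)
  have "ideal ?K (free_algebra L)"
  proof (rule idealI)
    show "subgroup ?K (add_monoid (free_algebra L))"
    proof (rule group.subgroupI[OF F.a_group])
      have "0 \<in> ?K" by (simp add: carrier_free_algebra)
      then show "?K \<noteq> {}" by blast
    next
      fix a assume a: "a \<in> ?K"
      have "free_act vscale act (- a) w = 0" for w
        using a free_act_minus[of 0 a w] by auto
      moreover have "- a \<in> carrier (free_algebra L)"
        using a by (simp add: carrier_free_algebra)
      ultimately show "inv\<^bsub>add_monoid (free_algebra L)\<^esub> a \<in> ?K"
        using a neg[of a] by simp
    next
      fix a b assume "a \<in> ?K" "b \<in> ?K"
      then show "a \<otimes>\<^bsub>add_monoid (free_algebra L)\<^esub> b \<in> ?K"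
        using F.a_closed[of a b] by (auto simp: free_act_add)
    qed auto
  next
    fix a x assume "a \<in> ?K" "x \<in> carrier (free_algebra L)"
    then show "x \<otimes>\<^bsub>free_algebra L\<^esub> a \<in> ?K" "a \<otimes>\<^bsub>free_algebra L\<^esub> x \<in> ?K"
      using F.m_closed[of x a] F.m_closed[of a x] by (auto simp: free_act_mult)
  qed (rule ring_free_algebra)
  moreover have "uea_relations scale bracket L \<subseteq> ?K"
    using uea_relations_subset[OF assms(1)] free_act_uea_relations by blast
  ultimately have "uea_ideal scale bracket L \<subseteq> ?K"
    unfolding uea_ideal_def by (rule F.genideal_minimal)
  then show ?thesis using assms(2) by blast
qed

lemma uea_act_class:
  assumes "lie_subalgebra L"
  shows "uea_act vscale act (uea_class scale bracket L q) u = free_act vscale act q u"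
proof -
  interpret I: ideal "uea_ideal scale bracket L" "free_algebra L"
    by (rule uea_ideal_ideal[OF assms])
  have "uea_class scale bracket L q = {r + q | r. r \<in> uea_ideal scale bracket L}"
    by (auto simp: uea_class_def a_r_coset_def')
  moreover have "0 \<in> uea_ideal scale bracket L"
    using additive_subgroup.zero_closed[OF I.additive_subgroup_axioms] by simp
  ultimately have "(\<lambda>q. free_act vscale act q u) ` uea_class scale bracket L q
      = {free_act vscale act q u}"
    using free_act_uea_ideal[OF assms] by (force simp: free_act_add image_iff)
  then show ?thesis by (simp add: uea_act_def)
qed

end


section \<open>The Virasoro algebra\<close>

datatype vir_index = Z | E int

text \<open>The complex vector space with basis \<^const>\<open>Z\<close> and \<^term>\<open>E i\<close>, where \<^term>\<open>i\<close> is an integer.\<close>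

type_synonym vir = "vir_index \<Rightarrow>\<^sub>0 complex"

definition vir_scale :: "complex \<Rightarrow> vir \<Rightarrow> vir" where
  "vir_scale a x = Poly_Mapping.map ((*) a) x"

definition vir_z :: vir where
  "vir_z = Poly_Mapping.single Z 1"

definition vir_e :: "int \<Rightarrow> vir" where
  "vir_e i = Poly_Mapping.single (E i) 1"

fun vir_basis_bracket :: "vir_index \<Rightarrow> vir_index \<Rightarrow> vir" where
  "vir_basis_bracket (E i) (E j) =
     vir_scale (of_int (j - i)) (vir_e (i + j))
     + (if j = - i then vir_scale (of_int (j ^ 3 - j) / 12) vir_z else 0)"
| "vir_basis_bracket (E i) Z = 0"
| "vir_basis_bracket Z (E i) = 0"
| "vir_basis_bracket Z Z = 0"

definition vir_bracket :: "vir \<Rightarrow> vir \<Rightarrow> vir" where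
  "vir_bracket x y =
     (\<Sum>a\<in>Poly_Mapping.keys x. \<Sum>b\<in>Poly_Mapping.keys y.
        vir_scale (Poly_Mapping.lookup x a * Poly_Mapping.lookup y b) (vir_basis_bracket a b))"

lemma lookup_vir_scale [simp]:
  "Poly_Mapping.lookup (vir_scale a x) k = a * Poly_Mapping.lookup x k"
  by (simp add: vir_scale_def Poly_Mapping.map.rep_eq when_def)

lemma vir_scale_single: "vir_scale a (Poly_Mapping.single k b) = Poly_Mapping.single k (a * b)"
  by (rule poly_mapping_eqI) (simp add: lookup_single when_def)

interpretation vir: vector_space vir_scale
  by standard (auto intro!: poly_mapping_eqI simp: lookup_add algebra_simps)

lemma vir_bracket_superset:
  assumes "finite A" "finite B" "Poly_Mapping.keys x \<subseteq> A" "Poly_Mapping.keys y \<subseteq> B"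
  shows "vir_bracket x y = (\<Sum>a\<in>A. \<Sum>b\<in>B.
    vir_scale (Poly_Mapping.lookup x a * Poly_Mapping.lookup y b) (vir_basis_bracket a b))"
proof -
  let ?f = "\<lambda>a b. vir_scale (Poly_Mapping.lookup x a * Poly_Mapping.lookup y b) (vir_basis_bracket a b)"
  have "(\<Sum>a\<in>A. \<Sum>b\<in>B. ?f a b) = (\<Sum>a\<in>A. \<Sum>b\<in>Poly_Mapping.keys y. ?f a b)"
    by (intro sum.cong refl sum.mono_neutral_right) (use assms in \<open>auto simp: in_keys_iff\<close>)
  also have "\<dots> = vir_bracket x y"
    unfolding vir_bracket_def
    by (rule sum.mono_neutral_right) (use assms in \<open>auto simp: in_keys_iff\<close>)
  finally show ?thesis by simp
qed

lemma vir_bracket_add_left: "vir_bracket (x + y) w = vir_bracket x w + vir_bracket y w"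
proof -
  let ?A = "Poly_Mapping.keys x \<union> Poly_Mapping.keys y" and ?B = "Poly_Mapping.keys w"
  show ?thesis
    using Poly_Mapping.keys_add[of x y]
    by (subst (1 2 3) vir_bracket_superset[where A = ?A and B = ?B])
       (auto simp: lookup_add distrib_right vir.scale_left_distrib sum.distrib)
qed

lemma vir_bracket_add_right: "vir_bracket w (x + y) = vir_bracket w x + vir_bracket w y"
proof -
  let ?B = "Poly_Mapping.keys x \<union> Poly_Mapping.keys y" and ?A = "Poly_Mapping.keys w"
  show ?thesis
    using Poly_Mapping.keys_add[of x y]
    by (subst (1 2 3) vir_bracket_superset[where A = ?A and B = ?B])
       (auto simp: lookup_add distrib_left vir.scale_left_distrib sum.distrib)
qed

lemma keys_vir_scale: "Poly_Mapping.keys (vir_scale a x) \<subseteq> Poly_Mapping.keys x"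
  by (auto simp: in_keys_iff)

lemma vir_bracket_scale_left: "vir_bracket (vir_scale a x) y = vir_scale a (vir_bracket x y)"
  by (subst vir_bracket_superset[where A = "Poly_Mapping.keys x" and B = "Poly_Mapping.keys y"])
     (auto simp: keys_vir_scale vir_bracket_def vir.scale_sum_right mult.assoc)

lemma vir_bracket_scale_right: "vir_bracket x (vir_scale a y) = vir_scale a (vir_bracket x y)"
  by (subst vir_bracket_superset[where A = "Poly_Mapping.keys x" and B = "Poly_Mapping.keys y"])
     (auto simp: keys_vir_scale vir_bracket_def vir.scale_sum_right mult_ac)

lemma vir_bracket_zero [simp]: "vir_bracket 0 x = 0" "vir_bracket x 0 = 0"
  by (simp_all add: vir_bracket_def)

lemma vir_bracket_single:
  "vir_bracket (Poly_Mapping.single a 1) (Poly_Mapping.single b 1) = vir_basis_bracket a b"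
  by (simp add: vir_bracket_def)

lemma vir_bracket_e_e: "vir_bracket (vir_e i) (vir_e j) =
   vir_scale (of_int (j - i)) (vir_e (i + j))
   + (if j = - i then vir_scale (of_int (j ^ 3 - j) / 12) vir_z else 0)"
  by (simp add: vir_e_def vir_bracket_single del: of_int_diff)

lemma vir_bracket_z [simp]: "vir_bracket vir_z x = 0" "vir_bracket x vir_z = 0"
proof -
  have "vir_basis_bracket Z a = 0" "vir_basis_bracket a Z = 0" for a
    by (cases a; simp)+
  then show "vir_bracket vir_z x = 0" "vir_bracket x vir_z = 0"
    by (simp_all add: vir_bracket_def vir_z_def)
qed

lemma vir_induct [case_names zero z e add scale]:
  assumes "P 0" "P vir_z" "\<And>i. P (vir_e i)" "\<And>x y. P x \<Longrightarrow> P y \<Longrightarrow> P (x + y)"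
    "\<And>a x. P x \<Longrightarrow> P (vir_scale a x)"
  shows "P x"
proof -
  have "x = (\<Sum>k\<in>Poly_Mapping.keys x.
      vir_scale (Poly_Mapping.lookup x k) (Poly_Mapping.single k 1))"
    using poly_mapping_eq_sum_single[of x] by (simp add: vir_scale_single)
  moreover have "P (Poly_Mapping.single k 1)" for k
    using assms(2,3) by (cases k) (auto simp: vir_z_def vir_e_def)
  then have "P (\<Sum>k\<in>A. vir_scale (Poly_Mapping.lookup x k) (Poly_Mapping.single k 1))" for A
    by (induction A rule: infinite_finite_induct) (auto intro: assms)
  ultimately show ?thesis by metis
qed

lemma vir_bracket_anti: "vir_bracket x y = - vir_bracket y x"
proof (induction x rule: vir_induct)
  case (e i)
  show ?case
  proof (induction y rule: vir_induct)
    case (e j)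
    show ?case
      by (rule poly_mapping_eqI)
         (simp add: vir_bracket_e_e lookup_add lookup_minus,
          auto simp: vir_e_def vir_z_def lookup_single when_def power3_eq_cube field_simps)
  qed (auto simp: vir_bracket_add_left vir_bracket_add_right vir_bracket_scale_left
      vir_bracket_scale_right)
qed (auto simp: vir_bracket_add_left vir_bracket_add_right vir_bracket_scale_left
      vir_bracket_scale_right)

lemma vir_jacobi:
  "vir_bracket x (vir_bracket y w) + vir_bracket y (vir_bracket w x)
   + vir_bracket w (vir_bracket x y) = 0" (is "?J x y w = 0")
proof -
  note lin = vir_bracket_add_left vir_bracket_add_right vir_bracket_scale_left
    vir_bracket_scale_right
  have add: "?J (x + x') y w = ?J x y w + ?J x' y w" "?J x (y + y') w = ?J x y w + ?J x y' w"
    "?J x y (w + w') = ?J x y w + ?J x y w'" for x x' y y' w w'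
    by (simp_all add: lin algebra_simps)
  have scale: "?J (vir_scale a x) y w = vir_scale a (?J x y w)"
    "?J x (vir_scale a y) w = vir_scale a (?J x y w)"
    "?J x y (vir_scale a w) = vir_scale a (?J x y w)" for a x y w
    by (simp_all add: lin vir.scale_right_distrib)
  have nested: "vir_bracket (vir_e i) (vir_bracket (vir_e j) (vir_e k)) =
      vir_scale (of_int ((k - j) * (j + k - i))) (vir_e (i + j + k))
      + vir_scale (if i + j + k = 0 then of_int ((k - j) * ((j + k) ^ 3 - (j + k))) / 12 else 0) vir_z"
    for i j k
    by (auto simp: vir_bracket_e_e lin add.assoc vir.scale_right_distrib simp del: of_int_diff)
  have eee: "?J (vir_e i) (vir_e j) (vir_e k) = 0" for i j k
  proof (rule poly_mapping_eqI)
    fix a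
    have *: "j + k + i = i + j + k" "k + i + j = i + j + k" by auto
    show "Poly_Mapping.lookup (?J (vir_e i) (vir_e j) (vir_e k)) a = Poly_Mapping.lookup 0 a"
    proof (cases "i + j + k = 0")
      case True
      then have k: "k = - i - j" by simp
      show ?thesis
        unfolding nested lookup_add lookup_vir_scale *
        by (simp add: k vir_e_def vir_z_def lookup_single when_def)
           (auto simp: power3_eq_cube algebra_simps add_divide_distrib diff_divide_distrib)
    next
      case False
      then show ?thesis
        unfolding nested lookup_add lookup_vir_scale *
        by (simp add: vir_e_def vir_z_def lookup_single when_def algebra_simps)
    qed
  qed
  have ee: "?J (vir_e i) (vir_e j) w = 0" for i j w
    by (induction w rule: vir_induct) (simp_all only: add scale eee, simp_all)
  have e: "?J (vir_e i) y w = 0" for i y w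
    by (induction y rule: vir_induct) (simp_all only: add scale ee, simp_all)
  show ?thesis
    by (induction x rule: vir_induct) (simp_all only: add scale e, simp_all)
qed

interpretation vir: lie_algebra vir_scale vir_bracket
proof
  fix x
  have "2 * Poly_Mapping.lookup (vir_bracket x x) k = 0" for k
    using arg_cong[OF vir_bracket_anti[of x x], of "\<lambda>x. Poly_Mapping.lookup x k"] by simp
  then show "vir_bracket x x = 0" by (auto intro!: poly_mapping_eqI)
qed (simp_all add: vir_bracket_add_left vir_bracket_add_right vir_bracket_scale_left
    vir_bracket_scale_right vir_jacobi)

definition L1 :: "vir set" where
  "L1 = vir.span {vir_e i | i. i \<ge> 1}"

lemma vir_e_in_L1: "i \<ge> 1 \<Longrightarrow> vir_e i \<in> L1"
  unfolding L1_def by (rule vir.span_base) auto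

lemma lie_subalgebra_L1: "vir.lie_subalgebra L1"
proof -
  have sub: "vir.subspace L1" by (simp add: L1_def)
  have e: "vir_bracket x (vir_e j) \<in> L1" if "x \<in> L1" "j \<ge> 1" for x j
    using that(1) unfolding L1_def
  proof (induction rule: vir.span_induct_alt)
    case (step c x y)
    then obtain i where "x = vir_e i" "i \<ge> 1" by auto
    moreover from this that(2) have "vir_bracket (vir_e i) (vir_e j) \<in> L1"
      by (auto simp: vir_bracket_e_e simp del: of_int_diff
          intro!: vir.subspace_scale[OF sub] vir_e_in_L1)
    ultimately show ?case using step(2) sub
      by (simp add: vir_bracket_add_left vir_bracket_scale_left L1_def vir.span_add vir.span_scale)
  qed (simp add: vir.span_zero)
  have "vir_bracket x y \<in> L1" if x: "x \<in> L1" and "y \<in> L1" for x y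
    using that(2) unfolding L1_def
  proof (induction rule: vir.span_induct_alt)
    case (step c y z)
    then obtain j where "y = vir_e j" "j \<ge> 1" by auto
    then show ?case using step(2) e[OF x, of j] sub
      by (simp add: vir_bracket_add_right vir_bracket_scale_right L1_def vir.span_add vir.span_scale)
  qed (simp add: vir.span_zero)
  with sub show ?thesis by (simp add: vir.lie_subalgebra_def)
qed


section \<open>Verma modules and singular vectors\<close>

text \<open>
  Bijectivity of \<open>u \<mapsto> u v\<close> says that the module is free over the enveloping algebra of
  \<^const>\<open>L1\<close> with generator \<open>v\<close>; in particular \<open>v\<close> generates the module.
\<close>

definition verma_module ::
  "complex \<Rightarrow> complex \<Rightarrow> (complex \<Rightarrow> 'v::ab_group_add \<Rightarrow> 'v) \<Rightarrow> (vir \<Rightarrow> 'v \<Rightarrow> 'v) \<Rightarrow> 'v \<Rightarrow> bool" where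
  "verma_module h c vscale act v \<longleftrightarrow>
     lie_module vir_scale vir_bracket vscale act
   \<and> act vir_z v = vscale c v
   \<and> act (vir_e 0) v = vscale h v
   \<and> (\<forall>i<0. act (vir_e i) v = 0)
   \<and> bij_betw (\<lambda>u. uea_act vscale act u v) (carrier (uea vir_scale vir_bracket L1)) UNIV"

definition singular_vector :: "(vir \<Rightarrow> 'v::ab_group_add \<Rightarrow> 'v) \<Rightarrow> 'v \<Rightarrow> bool" where
  "singular_vector act w \<longleftrightarrow> w \<noteq> 0 \<and> (\<forall>i<0. act (vir_e i) w = 0)"


section \<open>The element \<open>S\<close>\<close>

definition compositions :: "nat \<Rightarrow> nat list set" where
  "compositions n = {ks. ks \<noteq> [] \<and> (\<forall>k\<in>set ks. k \<ge> 1) \<and> sum_list ks = n}"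

text \<open>
  List positions start at \<open>0\<close>, so \<open>i\<^sub>m\<close> is \<^term>\<open>ks ! (m - 1)\<close>; the partial sum
  \<open>i\<^sub>1 + \<dots> + i\<^sub>m\<close> is \<^term>\<open>sum_list (take m ks)\<close>.
\<close>

definition f_coeff :: "nat \<Rightarrow> 'a::field \<Rightarrow> nat list \<Rightarrow> 'a" where
  "f_coeff p t ks =
     of_nat (fact (2 * p - 1)) ^ 2
     * (2 * t) powi (int (length ks) - 2 * int p)
     * (\<Prod>r = 1..2 * p - 1. of_nat p - t - of_nat r)
     * (\<Prod>m = 1..length ks. of_nat (ks ! (m - 1)) * (2 * t + 1)
          + 2 * (of_nat p - t - of_nat (sum_list (take m ks))))
     / ((\<Prod>l = 0..2 * p - 1. 2 * of_nat p - 1 - 2 * of_nat l)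
        * (\<Prod>l = 1..length ks - 1.
             of_nat (sum_list (take l ks))
             * (2 * of_nat p - of_nat (sum_list (take l ks)))
             * (of_nat p - t - of_nat (sum_list (take l ks)))))"

text \<open>
  The value of a rational function at a point, taken after cancellation: \<^const>\<open>quot_of_fract\<close>
  returns coprime numerator and denominator.
\<close>

definition rat_value :: "complex poly fract \<Rightarrow> complex \<Rightarrow> complex" where
  "rat_value q t = poly (fst (quot_of_fract q)) t / poly (snd (quot_of_fract q)) t"

definition rat_var :: "complex poly fract" where
  "rat_var = to_fract [:0, 1:]"

lemma rat_value_Fract:
  assumes "poly b t \<noteq> 0"
  shows "rat_value (Fraction_Field.Fract a b) t = poly a t / poly b t"
proof -
  have "b \<noteq> 0" using assms by auto
  then obtain d where d: "a = fst (normalize_quot (a, b)) * d" "b = snd (normalize_quot (a, b)) * d"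
    using normalize_quot_aux[of b a] by blast
  define n m where "n = fst (normalize_quot (a, b))" and "m = snd (normalize_quot (a, b))"
  have "rat_value (Fraction_Field.Fract a b) t = poly n t / poly m t"
    using quot_of_fract_quot_to_fract[of "(a, b)"]
    by (simp add: rat_value_def quot_to_fract_def n_def m_def)
  moreover have "a = n * d" "b = m * d"
    using d by (simp_all only: n_def m_def)
  ultimately show ?thesis using assms by simp
qed

definition S_2p :: "nat \<Rightarrow> complex \<Rightarrow> (vir free_monoid \<Rightarrow>\<^sub>0 complex) set" where
  "S_2p p t = uea_class vir_scale vir_bracket L1
     (\<Sum>ks\<in>compositions (2 * p).
        Poly_Mapping.single (FM (map (\<lambda>k. vir_e (int k)) ks)) (rat_value (f_coeff p rat_var ks) t))"

end

theory Submission
  imports Defs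
begin

text \<open>
  The coefficient \<open>f\<^sub>p\<close> is, up to a constant, a product along the composition: each letter has a
  factor that depends on its size and on a partial sum, and each partial sum has a factor of its own.
  Summing such products over all compositions of \<open>n\<close> gives vectors \<open>u\<^sub>n\<close> with \<open>u\<^sub>0 = v\<close> and
  \<open>n (2 p - n) / (2 t) u\<^sub>n = (\<Sum>m<n. a\<^sub>n\<^sub>m e\<^bsub>n-m\<^esub> u\<^sub>m)\<close> for \<open>n < 2 p\<close>, while \<open>S v\<close> is proportional to
  the right-hand side for \<open>n = 2 p\<close>. The numerator \<open>\<Prod>\<^sub>r (p - t - r)\<close> is distributed over the
  \<open>a\<^sub>n\<^sub>m\<close> such that the letter from level \<open>m\<close> to level \<open>n\<close> carries the factors strictly in between. These
  are the factors that are not cancelled, so the recursion makes sense for every \<open>t \<noteq> 0\<close> and no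
  limit at the zeros of \<open>p - t - r\<close> is taken (\<open>rat_value_f_coeff\<close>).

  The main point is that \<open>e\<^sub>-\<^sub>1\<close> and \<open>e\<^sub>-\<^sub>2\<close> map \<open>u\<^sub>n\<close> to explicit multiples of \<open>u\<^sub>n\<^sub>-\<^sub>1\<close> and
  \<open>u\<^sub>n\<^sub>-\<^sub>2\<close>. Apply \<open>e\<^sub>-\<^sub>j\<close> to the right-hand side of the recursion for \<open>u\<^sub>n\<close> and move it to the right. By
  induction the terms that contain a raising operator combine to a multiple of the right-hand side of
  the recursion for \<open>u\<^bsub>n-j\<^esub>\<close>; this is a linear identity between the factors of the letters
  (\<open>step_lowering_identity1\<close>, \<open>step_lowering_identity2\<close>). What remains are multiples of \<open>u\<^bsub>n-j\<^esub>\<close>,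
  which add up correctly for the given \<open>h\<close> and \<open>c\<close> (\<open>scalar_identity1\<close>, \<open>scalar_identity2\<close>). The result
  is \<open>e\<^sub>-\<^sub>j (\<Sum>m<n. a\<^sub>n\<^sub>m e\<^bsub>n-m\<^esub> u\<^sub>m) = \<lambda> n (2 p - n) u\<^bsub>n-j\<^esub>\<close> with a scalar \<open>\<lambda>\<close> that depends on \<open>n\<close>
  and \<open>j\<close>. For \<open>0 < n < 2 p\<close> this continues the induction, and for \<open>n = 2 p\<close> it says that \<open>S v\<close> is
  annihilated by \<open>e\<^sub>-\<^sub>1\<close> and \<open>e\<^sub>-\<^sub>2\<close>, hence by all \<open>e\<^sub>-\<^sub>k\<close> (\<open>act_neg_level_2p\<close>).

  Freeness of the Verma module reduces \<open>S v \<noteq> 0\<close> to \<open>S \<noteq> 0\<close> in the enveloping algebra of \<open>L\<^sub>1\<close>. Brackets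
  in \<open>L\<^sub>1\<close> have degree at least \<open>3\<close>, so \<open>e\<^sub>1 \<mapsto> 1\<close> and \<open>e\<^sub>k \<mapsto> 0\<close> for \<open>k \<ge> 2\<close> defines a character. It
  sends \<open>S\<close> to the coefficient of \<open>e\<^sub>1\<^bsup>2p\<^esup>\<close>, which is \<open>1\<close> (\<open>e1_power_coefficient_zero\<close>,
  \<open>rat_value_f_coeff_ones\<close>).
\<close>

section \<open>Coefficients as path weights\<close>

text \<open>
  The factor \<open>p - t - r\<close> of \<open>f\<^sub>p\<close>, indexed by the level \<open>n = 2 p - r\<close> at which it occurs.
\<close>

definition offset :: "nat \<Rightarrow> 'a::field \<Rightarrow> nat \<Rightarrow> 'a" where
  "offset p t n = of_nat n - of_nat p - t"

definition letter_coeff :: "nat \<Rightarrow> 'a::field \<Rightarrow> nat \<Rightarrow> nat \<Rightarrow> 'a" where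
  "letter_coeff p t n m = (of_nat n - of_nat m) * (2 * t + 1) + 2 * offset p t m"

text \<open>
  A letter that leads from level \<open>m\<close> to level \<open>n\<close> receives, besides its own factor, the offsets of
  all levels that it jumps over. These are exactly the factors of the full product of offsets that
  survive the cancellation in \<open>f\<^sub>p\<close>; distributed in this way they leave no pole in \<open>t\<close> except at
  \<open>0\<close>.
\<close>

definition step_coeff :: "nat \<Rightarrow> 'a::field \<Rightarrow> nat \<Rightarrow> nat \<Rightarrow> 'a" where
  "step_coeff p t n m = letter_coeff p t n m * (\<Prod>i\<in>{m<..<n}. offset p t i)"

text \<open>
  The general formula would divide by zero at the top level \<open>2 p\<close>, where \<open>f\<^sub>p\<close> has no vertex
  factor.
\<close>

definition level_factor :: "nat \<Rightarrow> 'a::field \<Rightarrow> nat \<Rightarrow> 'a" where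
  "level_factor p t n =
     (if n = 2 * p then 1 else 2 * t / (of_nat n * (2 * of_nat p - of_nat n)))"

text \<open>
  A word acts on the generator from the right, so the tail sum is the level from which the first
  letter starts.
\<close>

primrec weight :: "nat \<Rightarrow> 'a::field \<Rightarrow> nat list \<Rightarrow> 'a" where
  "weight p t [] = 1"
| "weight p t (k # ks) =
     level_factor p t (k + sum_list ks) * step_coeff p t (k + sum_list ks) (sum_list ks)
     * weight p t ks"

lemma prod_letters_Cons:
  "(\<Prod>m = 1..length (k # ks). F ((k # ks) ! (m - 1)) (sum_list (drop m (k # ks)))) =
   (F k (sum_list ks) :: 'a::comm_monoid_mult)
     * (\<Prod>m = 1..length ks. F (ks ! (m - 1)) (sum_list (drop m ks)))"
proof -
  have "(\<Prod>m = 1..Suc (length ks). F ((k # ks) ! (m - 1)) (sum_list (drop m (k # ks)))) =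
      F k (sum_list ks) * (\<Prod>m = Suc 1..Suc (length ks). F ((k # ks) ! (m - 1)) (sum_list (drop m (k # ks))))"
    by (subst prod.atLeast_Suc_atMost) simp_all
  also have "(\<Prod>m = Suc 1..Suc (length ks). F ((k # ks) ! (m - 1)) (sum_list (drop m (k # ks)))) =
      (\<Prod>m = 1..length ks. F (ks ! (m - 1)) (sum_list (drop m ks)))"
    unfolding prod.shift_bounds_cl_Suc_ivl by (rule prod.cong) auto
  finally show ?thesis by simp
qed

lemma prod_proper_suffixes_Cons:
  assumes "ks \<noteq> []"
  shows "(\<Prod>l = 1..length (k # ks) - 1. G (sum_list (drop l (k # ks)))) =
   (G (sum_list ks) :: 'a::comm_monoid_mult) * (\<Prod>l = 1..length ks - 1. G (sum_list (drop l ks)))"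
proof -
  obtain s where s: "length ks = Suc s" using assms by (cases ks) auto
  have "(\<Prod>l = 1..Suc s. G (sum_list (drop l (k # ks)))) =
      G (sum_list ks) * (\<Prod>l = Suc 1..Suc s. G (sum_list (drop l (k # ks))))"
    by (subst prod.atLeast_Suc_atMost) simp_all
  also have "(\<Prod>l = Suc 1..Suc s. G (sum_list (drop l (k # ks)))) =
      (\<Prod>l = 1..s. G (sum_list (drop l ks)))"
    unfolding prod.shift_bounds_cl_Suc_ivl by (rule prod.cong) auto
  finally show ?thesis using s by simp
qed

text \<open>
  Every suffix sum occurs once as a vertex of the path of levels, and each vertex factor of the
  recursion combines with the offset at that level, which no letter jumps over. For generic \<open>t\<close>
  this is the quotient that appears in \<open>f\<^sub>p\<close>, up to constants.
\<close>

lemma weight_eq_prod: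
  assumes "ks \<noteq> []" "0 \<notin> set ks" "sum_list ks \<le> 2 * p"
    and nz: "\<And>n. 0 < n \<Longrightarrow> n < 2 * p \<Longrightarrow> offset p t n \<noteq> 0"
  shows "weight p t ks = level_factor p t (sum_list ks)
    * (2 * t) ^ (length ks - 1)
    * (\<Prod>n\<in>{0<..<sum_list ks}. offset p t n)
    * (\<Prod>m = 1..length ks. of_nat (ks ! (m - 1)) * (2 * t + 1)
          + 2 * offset p t (sum_list (drop m ks)))
    / (\<Prod>l = 1..length ks - 1. of_nat (sum_list (drop l ks))
          * (2 * of_nat p - of_nat (sum_list (drop l ks))) * offset p t (sum_list (drop l ks)))"
  using assms(1-3)
proof (induction ks)
  case (Cons k ks)
  let ?L = "\<lambda>k m. of_nat k * (2 * t + 1) + 2 * offset p t m"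
  let ?V = "\<lambda>m. of_nat m * (2 * of_nat p - of_nat m) * offset p t m"
  show ?case
  proof (cases "ks = []")
    case True
    then show ?thesis by (simp add: step_coeff_def letter_coeff_def)
  next
    case False
    define m where "m = sum_list ks"
    have m: "0 < m" using Cons.prems False by (cases ks) (auto simp: m_def)
    have k: "0 < k" "k + m \<le> 2 * p" using Cons.prems by (auto simp: m_def)
    \<comment> \<open>The offset of the suffix sum \<open>m\<close> is the one that cancels against the denominator;
      the other offsets below \<open>k + m\<close> belong to the tail or to the new letter.\<close>
    have "{0<..<k + m} = insert m ({0<..<m} \<union> {m<..<k + m})"
      using k m by auto
    then have split: "(\<Prod>n\<in>{0<..<k + m}. offset p t n) =
        offset p t m * ((\<Prod>n\<in>{0<..<m}. offset p t n) * (\<Prod>n\<in>{m<..<k + m}. offset p t n))"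
      by (simp add: prod.union_disjoint)
    have IH: "weight p t ks = level_factor p t m * (2 * t) ^ (length ks - 1)
        * (\<Prod>n\<in>{0<..<m}. offset p t n)
        * (\<Prod>i = 1..length ks. ?L (ks ! (i - 1)) (sum_list (drop i ks)))
        / (\<Prod>l = 1..length ks - 1. ?V (sum_list (drop l ks)))"
      unfolding m_def by (rule Cons.IH) (use Cons.prems False in auto)
    have d: "level_factor p t m = 2 * t / (of_nat m * (2 * of_nat p - of_nat m))"
      using k by (simp add: level_factor_def)
    have a: "offset p t m \<noteq> 0" using nz[of m] m k by auto
    have len: "(2 * t) ^ (length (k # ks) - 1) = 2 * t * (2 * t) ^ (length ks - 1)"
      using False by (cases ks) auto
    have sl: "sum_list (k # ks) = k + m" by (simp add: m_def)
    show ?thesis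
      unfolding prod_letters_Cons[of ?L] prod_proper_suffixes_Cons[OF False, of ?V] len sl
        weight.simps m_def[symmetric] split
      unfolding IH d using a by (simp add: step_coeff_def letter_coeff_def mult_ac)
  qed
qed simp

text \<open>
  The partial sums in \<open>f\<^sub>p\<close> are complementary to the suffix sums in the weight. The constant in
  front is the same for all compositions, so it only rescales \<open>S v\<close>.
\<close>

lemma f_coeff_eq_weight:
  assumes "p \<ge> 1" and ks: "ks \<in> compositions (2 * p)" and "2 * t \<noteq> 0"
    and nz: "\<And>n. 0 < n \<Longrightarrow> n < 2 * p \<Longrightarrow> offset p t n \<noteq> 0"
  shows "f_coeff p t ks = of_nat (fact (2 * p - 1)) ^ 2
    / ((2 * t) ^ (2 * p - 1) * (\<Prod>l = 0..2 * p - 1. 2 * of_nat p - 1 - 2 * of_nat l)) * weight p t ks"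
proof -
  have sum: "sum_list ks = 2 * p" and ne: "ks \<noteq> []" and pos: "0 \<notin> set ks"
    using ks by (auto simp: compositions_def)
  have take: "(of_nat (sum_list (take m ks)) :: 'a) = 2 * of_nat p - of_nat (sum_list (drop m ks))" for m
  proof -
    have "sum_list (take m ks) + sum_list (drop m ks) = 2 * p"
      unfolding sum_list_append[symmetric] by (simp add: sum)
    then have "of_nat (sum_list (take m ks)) + of_nat (sum_list (drop m ks)) = (of_nat (2 * p) :: 'a)"
      unfolding of_nat_add[symmetric] by simp
    then show ?thesis by (simp add: algebra_simps)
  qed
  \<comment> \<open>Reversing \<open>r \<mapsto> 2 p - r\<close> turns \<open>p - t - r\<close> into an offset.\<close>
  have reversal: "(\<Prod>r = 1..2 * p - 1. of_nat p - t - of_nat r) = (\<Prod>n\<in>{0<..<2 * p}. offset p t n)"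
  proof (rule prod.reindex_bij_witness[of _ "\<lambda>n. 2 * p - n" "\<lambda>n. 2 * p - n"])
    fix r assume "r \<in> {1..2 * p - 1}"
    then show "offset p t (2 * p - r) = of_nat p - t - of_nat r"
      using of_nat_diff[of r "2 * p", where 'a = 'a] by (auto simp: offset_def)
  qed auto
  have pw: "(2 * t) powi (int (length ks) - 2 * int p) = (2 * t) ^ (length ks - 1) / (2 * t) ^ (2 * p - 1)"
  proof -
    have "int (length ks) - 2 * int p = int (length ks - 1) - int (2 * p - 1)"
      using ne \<open>p \<ge> 1\<close> by (cases ks) auto
    then show ?thesis using \<open>2 * t \<noteq> 0\<close> by (simp only: power_int_diff[OF disjI1[OF \<open>2 * t \<noteq> 0\<close>]] power_int_of_nat)
  qed
  have letters: "(\<Prod>m = 1..length ks. of_nat (ks ! (m - 1)) * (2 * t + 1)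
          + 2 * (of_nat p - t - of_nat (sum_list (take m ks))))
      = (\<Prod>m = 1..length ks. of_nat (ks ! (m - 1)) * (2 * t + 1) + 2 * offset p t (sum_list (drop m ks)))"
    unfolding take by (simp add: offset_def algebra_simps)
  have vertices: "(\<Prod>l = 1..length ks - 1. of_nat (sum_list (take l ks))
             * (2 * of_nat p - of_nat (sum_list (take l ks)))
             * (of_nat p - t - of_nat (sum_list (take l ks))))
      = (\<Prod>l = 1..length ks - 1. of_nat (sum_list (drop l ks))
          * (2 * of_nat p - of_nat (sum_list (drop l ks))) * offset p t (sum_list (drop l ks)))"
    unfolding take by (simp add: offset_def algebra_simps)
  have top: "level_factor p t (2 * p) = 1" by (simp add: level_factor_def)
  have W: "weight p t ks = (2 * t) ^ (length ks - 1)
    * (\<Prod>n\<in>{0<..<2 * p}. offset p t n)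
    * (\<Prod>m = 1..length ks. of_nat (ks ! (m - 1)) * (2 * t + 1)
          + 2 * offset p t (sum_list (drop m ks)))
    / (\<Prod>l = 1..length ks - 1. of_nat (sum_list (drop l ks))
          * (2 * of_nat p - of_nat (sum_list (drop l ks))) * offset p t (sum_list (drop l ks)))"
    using weight_eq_prod[OF ne pos _ nz] by (simp add: sum top)
  show ?thesis
    unfolding f_coeff_def letters vertices reversal pw W by (simp add: mult_ac)
qed

text \<open>
  The normalization of \<open>f\<^sub>p\<close>: for the word \<open>e\<^sub>1\<^bsup>2p\<^esup>\<close> the partial sums run through all of
  \<open>{1..2 p - 1}\<close>, so all offsets cancel, the vertex factors give the squared factorial, and the
  letters give the product of odd numbers in the denominator.
\<close>

lemma f_coeff_ones:
  fixes t :: "'a::field"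
  assumes "p \<ge> 1" and "2 * t \<noteq> 0"
    and nat_nz: "\<And>n. 0 < n \<Longrightarrow> n < 2 * p \<Longrightarrow> (of_nat n :: 'a) \<noteq> 0"
    and odd_nz: "(\<Prod>l = 0..2 * p - 1. 2 * of_nat p - 1 - 2 * of_nat l :: 'a) \<noteq> 0"
    and nz: "\<And>n. 0 < n \<Longrightarrow> n < 2 * p \<Longrightarrow> offset p t n \<noteq> 0"
  shows "f_coeff p t (replicate (2 * p) 1) = 1"
proof -
  have letters: "(\<Prod>m = 1..2 * p. of_nat (replicate (2 * p) 1 ! (m - 1)) * (2 * t + 1)
          + 2 * (of_nat p - t - of_nat (sum_list (take m (replicate (2 * p) (1::nat))))))
      = (\<Prod>l = 0..2 * p - 1. 2 * of_nat p - 1 - 2 * of_nat l :: 'a)"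
  proof (rule prod.reindex_bij_witness[of _ Suc "\<lambda>m. m - 1"])
    fix m assume "m \<in> {1..2 * p}"
    then have "replicate (2 * p) (1::nat) ! (m - 1) = 1" by (auto simp del: One_nat_def)
    then show "2 * of_nat p - 1 - 2 * of_nat (m - 1) =
        of_nat (replicate (2 * p) 1 ! (m - 1)) * (2 * t + 1)
          + 2 * (of_nat p - t - of_nat (sum_list (take m (replicate (2 * p) (1::nat)))))"
      using \<open>m \<in> {1..2 * p}\<close> by (simp add: sum_list_replicate algebra_simps)
  qed (use assms(1) in auto)
  have reversal: "(\<Prod>l = 1..2 * p - 1. F (2 * p - l)) = (\<Prod>l = 1..2 * p - 1. F l :: 'a)" for F
    by (rule prod.reindex_bij_witness[of _ "\<lambda>n. 2 * p - n" "\<lambda>n. 2 * p - n"]) auto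
  have "(\<Prod>l = 1..2 * p - 1. of_nat (sum_list (take l (replicate (2 * p) (1::nat))))
             * (2 * of_nat p - of_nat (sum_list (take l (replicate (2 * p) (1::nat)))))
             * (of_nat p - t - of_nat (sum_list (take l (replicate (2 * p) (1::nat))))))
      = (\<Prod>l = 1..2 * p - 1. of_nat l * of_nat (2 * p - l) * (of_nat p - t - of_nat l))"
  proof (rule prod.cong)
    fix l assume "l \<in> {1..2 * p - 1}"
    then have "l < 2 * p" by auto
    then show "of_nat (sum_list (take l (replicate (2 * p) (1::nat))))
             * (2 * of_nat p - of_nat (sum_list (take l (replicate (2 * p) (1::nat)))))
             * (of_nat p - t - of_nat (sum_list (take l (replicate (2 * p) (1::nat)))))
        = of_nat l * of_nat (2 * p - l) * (of_nat p - t - of_nat l)"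
      using of_nat_diff[of l "2 * p", where 'a = 'a] by (simp add: sum_list_replicate)
  qed simp
  also have "\<dots> = of_nat (fact (2 * p - 1)) ^ 2 * (\<Prod>l = 1..2 * p - 1. of_nat p - t - of_nat l)"
    unfolding prod.distrib reversal[of of_nat]
    by (simp add: fact_prod power2_eq_square)
  finally have vertices: "(\<Prod>l = 1..2 * p - 1. of_nat (sum_list (take l (replicate (2 * p) (1::nat))))
             * (2 * of_nat p - of_nat (sum_list (take l (replicate (2 * p) (1::nat)))))
             * (of_nat p - t - of_nat (sum_list (take l (replicate (2 * p) (1::nat))))))
      = of_nat (fact (2 * p - 1)) ^ 2 * (\<Prod>l = 1..2 * p - 1. of_nat p - t - of_nat l)" .
  have "(of_nat (fact (2 * p - 1)) :: 'a) = (\<Prod>l = 1..2 * p - 1. of_nat l)"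
    by (simp add: fact_prod)
  also have "\<dots> \<noteq> 0"
    unfolding prod_zero_iff[OF finite_atLeastAtMost] using nat_nz by fastforce
  finally have fact_nz: "(of_nat (fact (2 * p - 1)) :: 'a) \<noteq> 0" .
  have "of_nat p - t - of_nat l \<noteq> 0" if "l \<in> {1..2 * p - 1}" for l
  proof -
    have l: "0 < l" "l < 2 * p" using that by auto
    then have "offset p t (2 * p - l) = of_nat p - t - of_nat l"
      using of_nat_diff[of l "2 * p", where 'a = 'a] by (simp add: offset_def)
    then show ?thesis using nz[of "2 * p - l"] l by simp
  qed
  then have off_nz: "(\<Prod>l = 1..2 * p - 1. of_nat p - t - of_nat l) \<noteq> 0"
    unfolding prod_zero_iff[OF finite_atLeastAtMost] by blast
  have "int (length (replicate (2 * p) (1::nat))) - 2 * int p = 0" by simp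
  then show ?thesis
    unfolding f_coeff_def length_replicate letters vertices
    using fact_nz off_nz odd_nz by simp
qed

section \<open>Values of rational functions\<close>

text \<open>
  \<open>q\<close> lies in the local ring of functions regular at \<open>t\<close> and has value \<open>y\<close> there. Unlike
  \<^const>\<open>rat_value\<close>, which is also defined at poles, this is compatible with the field operations.
\<close>

definition takes_value :: "complex poly fract \<Rightarrow> complex \<Rightarrow> complex \<Rightarrow> bool" where
  "takes_value q t y \<longleftrightarrow> (\<exists>a b. poly b t \<noteq> 0 \<and> q = Fraction_Field.Fract a b \<and> y = poly a t / poly b t)"

lemma rat_value_eqI: "takes_value q t y \<Longrightarrow> rat_value q t = y"
  by (auto simp: takes_value_def rat_value_Fract)

lemma takes_value_poly: "takes_value (to_fract a) t (poly a t)"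
  unfolding takes_value_def by (rule exI[of _ a], rule exI[of _ 1]) (simp add: to_fract_def)

lemma takes_value_var: "takes_value rat_var t t"
  using takes_value_poly[of "[:0, 1:]" t] by (simp add: rat_var_def)

lemma takes_value_of_nat: "takes_value (of_nat n) t (of_nat n)"
  using takes_value_poly[of "of_nat n" t] by (simp add: to_fract_def of_nat_fract)

lemma takes_value_add:
  "takes_value q t x \<Longrightarrow> takes_value r t y \<Longrightarrow> takes_value (q + r) t (x + y)"
  unfolding takes_value_def
proof (elim exE conjE)
  fix a b a' b'
  assume *: "poly b t \<noteq> 0" "q = Fraction_Field.Fract a b" "x = poly a t / poly b t"
    "poly b' t \<noteq> 0" "r = Fraction_Field.Fract a' b'" "y = poly a' t / poly b' t"
  then have "b \<noteq> 0" "b' \<noteq> 0" by auto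
  with * show "\<exists>c d. poly d t \<noteq> 0 \<and> q + r = Fraction_Field.Fract c d \<and> x + y = poly c t / poly d t"
    by (intro exI[of _ "a * b' + a' * b"] exI[of _ "b * b'"]) (auto simp: add_frac_eq)
qed

lemma takes_value_mult:
  "takes_value q t x \<Longrightarrow> takes_value r t y \<Longrightarrow> takes_value (q * r) t (x * y)"
  unfolding takes_value_def
  by (elim exE conjE, rule_tac x = "a * aa" in exI, rule_tac x = "b * ba" in exI) auto

lemma takes_value_uminus: "takes_value q t x \<Longrightarrow> takes_value (- q) t (- x)"
  unfolding takes_value_def
  by (elim exE conjE, rule_tac x = "- a" in exI, rule_tac x = "b" in exI) auto

lemma takes_value_diff:
  "takes_value q t x \<Longrightarrow> takes_value r t y \<Longrightarrow> takes_value (q - r) t (x - y)"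
  using takes_value_add[OF _ takes_value_uminus, of q t x r y] by simp

lemma takes_value_inverse:
  "takes_value q t x \<Longrightarrow> x \<noteq> 0 \<Longrightarrow> takes_value (inverse q) t (inverse x)"
  unfolding takes_value_def
  by (elim exE conjE, rule_tac x = "b" in exI, rule_tac x = "a" in exI) auto

lemma takes_value_divide:
  "takes_value q t x \<Longrightarrow> takes_value r t y \<Longrightarrow> y \<noteq> 0 \<Longrightarrow> takes_value (q / r) t (x / y)"
  by (simp add: field_class.field_divide_inverse takes_value_mult takes_value_inverse)

lemma takes_value_prod:
  "(\<And>i. i \<in> I \<Longrightarrow> takes_value (q i) t (x i)) \<Longrightarrow> takes_value (\<Prod>i\<in>I. q i) t (\<Prod>i\<in>I. x i)"
proof (induction I rule: infinite_finite_induct)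
  case (insert i I)
  then show ?case by (simp add: takes_value_mult)
qed (use takes_value_of_nat[of 1] in auto)

lemma takes_value_power: "takes_value q t x \<Longrightarrow> takes_value (q ^ n) t (x ^ n)"
  using takes_value_prod[of "{..<n}" "\<lambda>_. q" t "\<lambda>_. x"] by simp

lemma takes_value_one: "takes_value 1 t 1"
  using takes_value_of_nat[of 1] by simp

lemma takes_value_numeral: "takes_value (numeral k) t (numeral k)"
  using takes_value_of_nat[of "numeral k"] by simp

lemmas takes_value_intros = takes_value_var takes_value_of_nat takes_value_one takes_value_numeral
  takes_value_add takes_value_diff takes_value_mult takes_value_divide takes_value_prod
  takes_value_power

lemma takes_value_nonzero: "takes_value q t y \<Longrightarrow> y \<noteq> 0 \<Longrightarrow> q \<noteq> 0"
  using rat_value_eqI[of q t y] rat_value_eqI[OF takes_value_of_nat[of 0 t]] by auto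

lemma takes_value_offset: "takes_value (offset p rat_var n) t (offset p t n)"
  unfolding offset_def by (intro takes_value_intros)

lemma takes_value_level_factor:
  assumes "0 < n"
  shows "takes_value (level_factor p rat_var n) t (level_factor p t n)"
proof (cases "n = 2 * p")
  case False
  then have "(of_nat n :: complex) \<noteq> of_nat (2 * p)"
    unfolding of_nat_eq_iff .
  then have "(of_nat n :: complex) * (2 * of_nat p - of_nat n) \<noteq> 0"
    using assms by simp
  then show ?thesis using False
    unfolding level_factor_def by (auto intro!: takes_value_intros)
qed (simp add: level_factor_def takes_value_intros)

lemma takes_value_weight:
  assumes "0 \<notin> set ks"
  shows "takes_value (weight p rat_var ks) t (weight p t ks)"
  using assms
proof (induction ks)
  case (Cons k ks)
  then have "takes_value (weight p rat_var ks) t (weight p t ks)" "0 < k + sum_list ks"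
    by auto
  then show ?case
    unfolding weight.simps step_coeff_def letter_coeff_def
    by (intro takes_value_mult takes_value_level_factor takes_value_prod takes_value_offset
        takes_value_intros)
qed (simp add: takes_value_intros)

lemma offset_rat_var_nonzero: "offset p rat_var n \<noteq> 0"
  by (rule takes_value_nonzero[OF takes_value_offset[of p n "of_nat n - of_nat p + 1"]])
     (simp add: offset_def)

lemma two_rat_var_nonzero: "2 * rat_var \<noteq> 0"
  by (rule takes_value_nonzero[of _ 1 "2 * 1"]) (intro takes_value_intros, simp)

lemma odd_prod_nonzero:
  "(\<Prod>l = 0..2 * p - 1. 2 * of_nat p - 1 - 2 * of_nat l :: 'a::field_char_0) \<noteq> 0"
proof -
  have "(2 * of_nat p - 1 - 2 * of_nat l :: 'a) \<noteq> 0" for l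
  proof -
    have "2 * int p - 1 - 2 * int l \<noteq> 0" by presburger
    then have "(of_int (2 * int p - 1 - 2 * int l) :: 'a) \<noteq> 0"
      unfolding of_int_eq_0_iff .
    then show ?thesis by simp
  qed
  then show ?thesis by simp
qed

text \<open>
  The identity between \<open>f\<^sub>p\<close> and the weight holds in the field of rational functions, where no
  offset is zero; the weight is regular at every nonzero \<open>t\<close>, so both sides can be evaluated there,
  including those \<open>t\<close> at which some offset vanishes.
\<close>

lemma rat_value_f_coeff:
  assumes "p \<ge> 1" "t \<noteq> 0" "ks \<in> compositions (2 * p)"
  shows "rat_value (f_coeff p rat_var ks) t = of_nat (fact (2 * p - 1)) ^ 2
    / ((2 * t) ^ (2 * p - 1) * (\<Prod>l = 0..2 * p - 1. 2 * of_nat p - 1 - 2 * of_nat l)) * weight p t ks"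
proof (rule rat_value_eqI)
  show "takes_value (f_coeff p rat_var ks) t (of_nat (fact (2 * p - 1)) ^ 2
    / ((2 * t) ^ (2 * p - 1) * (\<Prod>l = 0..2 * p - 1. 2 * of_nat p - 1 - 2 * of_nat l)) * weight p t ks)"
    using assms odd_prod_nonzero[where 'a = complex]
    by (subst f_coeff_eq_weight[OF assms(1,3) two_rat_var_nonzero])
       (auto simp: offset_rat_var_nonzero compositions_def
         intro!: takes_value_intros takes_value_weight simp del: of_nat_fact)
qed

lemma rat_value_f_coeff_ones:
  assumes "p \<ge> 1" "t \<noteq> 0"
  shows "rat_value (f_coeff p rat_var (replicate (2 * p) 1)) t = 1"
proof -
  have "f_coeff p rat_var (replicate (2 * p) 1) = 1"
  proof (rule f_coeff_ones[OF assms(1)])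
    show "2 * rat_var \<noteq> 0" by (rule two_rat_var_nonzero)
    show "(of_nat n :: complex poly fract) \<noteq> 0" if "0 < n" for n
      using that by (intro takes_value_nonzero[OF takes_value_of_nat]) auto
    show "(\<Prod>l = 0..2 * p - 1. 2 * of_nat p - 1 - 2 * of_nat l :: complex poly fract) \<noteq> 0"
      by (rule takes_value_nonzero[OF _ odd_prod_nonzero[of p], of _ 0]) (intro takes_value_intros)
  qed (rule offset_rat_var_nonzero)
  then show ?thesis using rat_value_eqI[OF takes_value_one] by simp
qed

section \<open>Sums over compositions\<close>

text \<open>
  In contrast to \<^const>\<open>compositions\<close>, the empty list is admitted at level \<open>0\<close>; it starts the
  recursion.
\<close>

definition weak_compositions :: "nat \<Rightarrow> nat list set" where
  "weak_compositions n = {ks. 0 \<notin> set ks \<and> sum_list ks = n}"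

lemma finite_weak_compositions: "finite (weak_compositions n)"
proof -
  have "length ks \<le> sum_list ks" if "0 \<notin> set ks" for ks :: "nat list"
    using that by (induction ks) auto
  then have "weak_compositions n \<subseteq> {ks. set ks \<subseteq> {..n} \<and> length ks \<le> n}"
    by (auto simp: weak_compositions_def member_le_sum_list)
  then show ?thesis
    by (rule finite_subset) (simp add: finite_lists_length_le)
qed

lemma weak_compositions_0: "weak_compositions 0 = {[]}"
proof -
  have "ks = []" if "0 \<notin> set ks" "sum_list ks = 0" for ks :: "nat list"
    using that by (cases ks) auto
  then show ?thesis by (auto simp: weak_compositions_def)
qed

lemma weak_compositions_eq: "n > 0 \<Longrightarrow> weak_compositions n = compositions n"
  by (auto simp: weak_compositions_def compositions_def Suc_le_eq intro: gr0I)

lemma sum_weak_compositions: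
  assumes "n > 0"
  shows "(\<Sum>ks\<in>weak_compositions n. F ks) =
    (\<Sum>m<n. \<Sum>ks\<in>weak_compositions m. F ((n - m) # ks) :: 'b::comm_monoid_add)"
proof -
  have "(\<Sum>ks\<in>weak_compositions n. F ks) =
      (\<Sum>(m, ks)\<in>(SIGMA m:{..<n}. weak_compositions m). F ((n - m) # ks))"
  proof (rule sum.reindex_bij_witness[of _ "\<lambda>(m, ks). (n - m) # ks" "\<lambda>ks. (sum_list (tl ks), tl ks)"])
    fix ks assume ks: "ks \<in> weak_compositions n"
    then obtain k ks' where "ks = k # ks'" using assms
      by (cases ks) (auto simp: weak_compositions_def)
    with ks show "(case (sum_list (tl ks), tl ks) of (m, ks) \<Rightarrow> (n - m) # ks) = ks"
      "(sum_list (tl ks), tl ks) \<in> (SIGMA m:{..<n}. weak_compositions m)"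
      "(case (sum_list (tl ks), tl ks) of (m, ks) \<Rightarrow> F ((n - m) # ks)) = F ks"
      by (auto simp: weak_compositions_def)
  qed (auto simp: weak_compositions_def)
  also have "\<dots> = (\<Sum>m<n. \<Sum>ks\<in>weak_compositions m. F ((n - m) # ks))"
    by (rule sum.Sigma[symmetric]) (auto simp: finite_weak_compositions)
  finally show ?thesis .
qed

section \<open>Identities behind the lowering formulas\<close>

text \<open>
  The two contributions to the coefficient of \<open>e\<^bsub>N-m\<^esub> u\<^sub>m\<close> when \<open>e\<^sub>-\<^sub>1\<close> is moved through
  level \<open>N + 1\<close>. That their sum is again a letter coefficient times a factor without \<open>m\<close>
  determines the factor \<open>n - p - 3 t - 2\<close> with which, up to the offset, \<open>e\<^sub>-\<^sub>1\<close> lowers level \<open>n\<close>.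
  The next lemma does the same for \<open>e\<^sub>-\<^sub>2\<close>.
\<close>

lemma letter_lowering_identity1:
  "letter_coeff p t (Suc N) m * (of_nat N + 2 - of_nat m)
     + letter_coeff p t (Suc N) (Suc m) * (of_nat (Suc m) - of_nat p - 3 * t - 2)
   = (of_nat N + 2 - of_nat p - 3 * t) * letter_coeff p t N m"
  unfolding letter_coeff_def offset_def by (simp add: algebra_simps)

lemma letter_lowering_identity2:
  "letter_coeff p t (N + 2) m * (of_nat N + 4 - of_nat m)
     + letter_coeff p t (N + 2) (m + 2) * (of_nat (m + 2) - of_nat p - 5 * t - 4)
   = (of_nat N + 4 - of_nat p - 5 * t) * letter_coeff p t N m"
  unfolding letter_coeff_def offset_def by (simp add: algebra_simps)

text \<open>
  The offset that \<open>e\<^sub>-\<^sub>1\<close> contributes at level \<open>m + 1\<close> is the one that the letter starting at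
  \<open>m + 1\<close> does not jump over. Thus both terms on the left carry the same product of offsets.
\<close>

lemma step_lowering_identity1:
  assumes "m < N"
  shows "step_coeff p t (Suc N) m * (of_nat N + 2 - of_nat m)
     + step_coeff p t (Suc N) (Suc m) * ((of_nat (Suc m) - of_nat p - 3 * t - 2) * offset p t (Suc m))
   = (of_nat N + 2 - of_nat p - 3 * t) * offset p t N * step_coeff p t N m"
proof -
  let ?P = "\<Prod>i\<in>{m<..<N}. offset p t i"
  have "{m<..<Suc N} = insert N {m<..<N}" using assms by auto
  then have P: "(\<Prod>i\<in>{m<..<Suc N}. offset p t i) = offset p t N * ?P" by simp
  have "{m<..<Suc N} = insert (Suc m) {Suc m<..<Suc N}" using assms by auto
  then have Q: "(\<Prod>i\<in>{m<..<Suc N}. offset p t i) =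
      offset p t (Suc m) * (\<Prod>i\<in>{Suc m<..<Suc N}. offset p t i)" by simp
  have "step_coeff p t (Suc N) m * (of_nat N + 2 - of_nat m)
     + step_coeff p t (Suc N) (Suc m) * ((of_nat (Suc m) - of_nat p - 3 * t - 2) * offset p t (Suc m))
     = (letter_coeff p t (Suc N) m * (of_nat N + 2 - of_nat m)
     + letter_coeff p t (Suc N) (Suc m) * (of_nat (Suc m) - of_nat p - 3 * t - 2))
       * (\<Prod>i\<in>{m<..<Suc N}. offset p t i)"
    unfolding step_coeff_def distrib_right by (subst (2) Q) (simp add: mult_ac)
  then show ?thesis
    unfolding letter_lowering_identity1 P step_coeff_def by (simp add: mult_ac)
qed

lemma step_lowering_identity2:
  assumes "m < N"
  shows "step_coeff p t (N + 2) m * (of_nat N + 4 - of_nat m)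
     + step_coeff p t (N + 2) (m + 2)
       * ((of_nat (m + 2) - of_nat p - 5 * t - 4) * offset p t (m + 2) * offset p t (m + 1))
   = (of_nat N + 4 - of_nat p - 5 * t) * offset p t N * offset p t (N + 1) * step_coeff p t N m"
proof -
  let ?P = "\<Prod>i\<in>{m<..<N}. offset p t i"
  have "{m<..<N + 2} = insert (N + 1) (insert N {m<..<N})" using assms by auto
  then have P: "(\<Prod>i\<in>{m<..<N + 2}. offset p t i) = offset p t (N + 1) * (offset p t N * ?P)" by simp
  have "{m<..<N + 2} = insert (m + 1) (insert (m + 2) {m + 2<..<N + 2})" using assms by auto
  then have Q: "(\<Prod>i\<in>{m<..<N + 2}. offset p t i) =
      offset p t (m + 1) * (offset p t (m + 2) * (\<Prod>i\<in>{m + 2<..<N + 2}. offset p t i))" by simp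
  have "step_coeff p t (N + 2) m * (of_nat N + 4 - of_nat m)
     + step_coeff p t (N + 2) (m + 2)
       * ((of_nat (m + 2) - of_nat p - 5 * t - 4) * offset p t (m + 2) * offset p t (m + 1))
     = (letter_coeff p t (N + 2) m * (of_nat N + 4 - of_nat m)
     + letter_coeff p t (N + 2) (m + 2) * (of_nat (m + 2) - of_nat p - 5 * t - 4))
       * (\<Prod>i\<in>{m<..<N + 2}. offset p t i)"
    unfolding step_coeff_def distrib_right by (subst (2) Q) (simp only: mult_ac)
  then show ?thesis
    unfolding letter_lowering_identity2 P step_coeff_def by (simp only: mult_ac)
qed

text \<open>
  The reciprocal of the factor at levels strictly between \<open>0\<close> and \<open>2 p\<close>, but zero at both ends.
\<close>

definition level_norm :: "nat \<Rightarrow> complex \<Rightarrow> nat \<Rightarrow> complex" where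
  "level_norm p t n = of_nat n * (2 * of_nat p - of_nat n) / (2 * t)"

text \<open>
  The scalar identities below, with \<open>w\<close> for \<open>1 / (2 t)\<close> and with polynomial hypotheses in place of
  divisions.
\<close>

lemma scalar_polynomial_identity1: fixes t w N p h :: complex
  assumes w: "2 * t * w = 1" and h: "4 * h = - ((p - 1 + t) * (2 * w * (p + 1) + 3))"
  shows "(N + 2 - p - 3 * t) * (N - p - t) * (N * (2 * p - N) * w)
      + ((N + 1 - N) * (2 * t + 1) + 2 * (N - p - t)) * (2 * (h + N))
    = (N + 1 - p - 3 * t - 2) * (N + 1 - p - t) * ((N + 1) * (2 * p - (N + 1)) * w)" (is "?l = ?r")
proof -
  \<comment> \<open>Once \<open>h\<close> is eliminated, the difference is affine in \<open>w\<close> and vanishes at \<open>w = 1 / (2 t)\<close>. So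
    it is \<open>1 - 2 t w\<close> times its value at \<open>w = 0\<close>.\<close>
  have "2 * (?l - ?r) = (1 - 2 * t * w) * ((1 + 2 * (N - p)) * (4 * N - 3 * (p - 1 + t)))
     + (1 + 2 * (N - p)) * (4 * h + ((p - 1 + t) * (2 * w * (p + 1) + 3)))"
    by (simp add: algebra_simps)
  also have "\<dots> = 0" using w h by simp
  finally show ?thesis by (simp only: mult_eq_0_iff right_minus_eq zero_neq_numeral[symmetric] simp_thms)
qed

lemma scalar_polynomial_identity2: fixes t w N p h C :: complex
  assumes w: "2 * t * w = 1" and h: "4 * h = - ((p - 1 + t) * (2 * w * (p + 1) + 3))"
    and c: "2 * C = 13 + 6 * t + 12 * w"
  shows "(N + 4 - p - 5 * t) * (N - p - t) * (N * (2 * p - N) * w)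
      + ((N + 2 - N) * (2 * t + 1) + 2 * (N - p - t)) * (4 * (h + N) + C)
      + ((N + 2 - (N + 1)) * (2 * t + 1) + 2 * (N + 1 - p - t)) * (3 * (N + 1 - p - 3 * t - 2))
    = (N + 2 - p - 5 * t - 4) * (N + 2 - p - t) * ((N + 2) * (2 * p - (N + 2)) * w)" (is "?l = ?r")
proof -
  \<comment> \<open>Again the cofactor of \<open>1 - 2 t w\<close> is the value of the difference at \<open>w = 0\<close>.\<close>
  have "2 * (?l - ?r) = (1 - 2 * t * w) * ((2 * (2 * t + 1) + 2 * (N - p - t)) * (8 * N - 6 * (p - 1 + t) + (13 + 6 * t))
     + (2 * t + 1 + 2 * (N + 1 - p - t)) * (6 * (N + 1 - p - 3 * t - 2)))
     + (2 * (2 * t + 1) + 2 * (N - p - t)) * (2 * (4 * h + ((p - 1 + t) * (2 * w * (p + 1) + 3)))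
       + (2 * C - (13 + 6 * t + 12 * w)))"
   by (simp add: algebra_simps)
  also have "\<dots> = 0" using w h c by simp
  finally show ?thesis by (simp only: mult_eq_0_iff right_minus_eq zero_neq_numeral[symmetric] simp_thms)
qed

text \<open>
  The multiples of \<open>u\<^sub>N\<close> that arise from applying \<open>e\<^sub>-\<^sub>1\<close> at level \<open>N + 1\<close>. Already the case \<open>N = 0\<close>
  forces the value of \<open>h\<close>; in the next lemma, the case \<open>N = 0\<close> forces that of \<open>c\<close> for generic \<open>t\<close>.
\<close>

lemma scalar_identity1:
  assumes t: "t \<noteq> 0"
    and h: "h = - ((of_nat p - 1 + t) * (inverse t * (of_nat p + 1) + 3)) / 4"
  shows "(of_nat N + 2 - of_nat p - 3 * t) * offset p t N * level_norm p t N
      + step_coeff p t (Suc N) N * (2 * (h + of_nat N))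
    = (of_nat (Suc N) - of_nat p - 3 * t - 2) * offset p t (Suc N) * level_norm p t (Suc N)"
proof -
  define w where "w = 1 / (2 * t)"
  have w: "2 * t * w = 1" "inverse t = 2 * w" using t by (simp_all add: w_def field_simps)
  have "{N<..<Suc N} = {}" by auto
  then have S: "step_coeff p t (Suc N) N = letter_coeff p t (Suc N) N"
    by (simp add: step_coeff_def)
  have n: "of_nat (Suc N) = (of_nat N + 1 :: complex)" by simp
  have l: "level_norm p t n = of_nat n * (2 * of_nat p - of_nat n) * w" for n
    by (simp add: level_norm_def w_def)
  have "4 * h = - ((of_nat p - 1 + t) * (2 * w * (of_nat p + 1) + 3))"
    unfolding h w(2) by simp
  from scalar_polynomial_identity1[OF w(1) this, of "of_nat N"] show ?thesis
    unfolding S letter_coeff_def l offset_def n .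
qed

lemma scalar_identity2:
  assumes t: "t \<noteq> 0"
    and c: "c = 13 + 6 * t + 6 * inverse t"
    and h: "h = - ((of_nat p - 1 + t) * (inverse t * (of_nat p + 1) + 3)) / 4"
  shows "(of_nat N + 4 - of_nat p - 5 * t) * offset p t N * offset p t (N + 1) * level_norm p t N
      + (step_coeff p t (N + 2) N * (4 * (h + of_nat N) + c / 2)
      + step_coeff p t (N + 2) (N + 1)
        * (3 * ((of_nat (N + 1) - of_nat p - 3 * t - 2) * offset p t (N + 1))))
    = (of_nat (N + 2) - of_nat p - 5 * t - 4) * offset p t (N + 2) * offset p t (N + 1)
      * level_norm p t (N + 2)" (is "?lhs = _")
proof -
  define w where "w = 1 / (2 * t)"
  have w: "2 * t * w = 1" "inverse t = 2 * w" using t by (simp_all add: w_def field_simps)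
  have "{N<..<N + 2} = {N + 1}" "{N + 1<..<N + 2} = {}" by auto
  then have S: "step_coeff p t (N + 2) N = letter_coeff p t (N + 2) N * offset p t (N + 1)"
    "step_coeff p t (N + 2) (N + 1) = letter_coeff p t (N + 2) (N + 1)"
    by (simp_all add: step_coeff_def)
  have n: "of_nat (N + 1) = (of_nat N + 1 :: complex)" "of_nat (N + 2) = (of_nat N + 2 :: complex)"
    by simp_all
  have l: "level_norm p t n = of_nat n * (2 * of_nat p - of_nat n) * w" for n
    by (simp add: level_norm_def w_def)
  have h': "4 * h = - ((of_nat p - 1 + t) * (2 * w * (of_nat p + 1) + 3))"
    unfolding h w(2) by simp
  have c': "2 * (c / 2) = 13 + 6 * t + 12 * w"
    unfolding c w(2) by simp
  have core: "(of_nat N + 4 - of_nat p - 5 * t) * offset p t N * level_norm p t N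
      + letter_coeff p t (N + 2) N * (4 * (h + of_nat N) + c / 2)
      + letter_coeff p t (N + 2) (N + 1) * (3 * (of_nat (N + 1) - of_nat p - 3 * t - 2))
    = (of_nat (N + 2) - of_nat p - 5 * t - 4) * offset p t (N + 2) * level_norm p t (N + 2)"
    (is "?l = ?r")
    using scalar_polynomial_identity2[OF w(1) h' c', of "of_nat N"]
    unfolding letter_coeff_def l offset_def n by (simp only: mult.assoc)
  have "?lhs = ?l * offset p t (N + 1)"
    unfolding S by (simp add: algebra_simps)
  also have "\<dots> = ?r * offset p t (N + 1)" by (simp only: core)
  finally show ?thesis by (simp only: mult_ac)
qed

section \<open>Lowering operators on raised vectors\<close>

text \<open>
  Annihilation is a matter of highest weight vectors in arbitrary modules; Verma modules enter
  through the claim that the vector is nonzero.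
\<close>

locale highest_weight_module = lie_module vir_scale vir_bracket vscale act
  for vscale :: "complex \<Rightarrow> 'v::ab_group_add \<Rightarrow> 'v" and act :: "vir \<Rightarrow> 'v \<Rightarrow> 'v" +
  fixes h c :: complex and v :: 'v
  assumes act_z_v: "act vir_z v = vscale c v"
    and act_e0_v: "act (vir_e 0) v = vscale h v"
    and act_e_neg_v: "i < 0 \<Longrightarrow> act (vir_e i) v = 0"
begin

lemma act_zero_left [simp]: "act 0 u = 0"
  using act_add_left[of 0 0 u] by simp

lemma act_zero_right [simp]: "act x 0 = 0"
  using act_add_right[of x 0 0] by simp

lemma act_sum_right: "act x (\<Sum>i\<in>I. f i) = (\<Sum>i\<in>I. act x (f i))"
  by (induction I rule: infinite_finite_induct) (auto simp: act_add_right)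

lemma act_e_e: "act (vir_e i) (act (vir_e j) u) = act (vir_e j) (act (vir_e i) u)
    + vscale (of_int j - of_int i) (act (vir_e (i + j)) u)
    + vscale (if j = - i then of_int (j ^ 3 - j) / 12 else 0) (act vir_z u)"
proof -
  have "act (vir_e i) (act (vir_e j) u) =
      act (vir_e j) (act (vir_e i) u) + act (vir_bracket (vir_e i) (vir_e j)) u"
    by (simp add: act_bracket)
  also have "act (vir_bracket (vir_e i) (vir_e j)) u = vscale (of_int j - of_int i) (act (vir_e (i + j)) u)
      + vscale (if j = - i then of_int (j ^ 3 - j) / 12 else 0) (act vir_z u)"
    unfolding vir_bracket_e_e
    by (simp only: act_add_left act_scale_left of_int_diff if_distrib[of "\<lambda>x. act x u"]) simp
  finally show ?thesis by (simp only: add.assoc)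
qed

lemma act_z_e: "act vir_z (act (vir_e i) u) = act (vir_e i) (act vir_z u)"
  using act_bracket[of vir_z "vir_e i" u] by simp

definition raise :: "(nat \<Rightarrow> nat \<Rightarrow> complex) \<Rightarrow> (nat \<Rightarrow> 'v) \<Rightarrow> nat \<Rightarrow> 'v" where
  "raise a u n = (\<Sum>m<n. vscale (a n m) (act (vir_e (int n - int m)) (u m)))"

text \<open>
  If \<open>e\<^sub>-\<^sub>1\<close> lowers the vectors below level \<open>N + 1\<close> to multiples of each other, and the coefficients
  \<open>a\<close> match in the sense of \<open>step\<close>, then it lowers the next raised vector to the previous raised
  vector, up to a multiple of \<open>u\<^sub>N\<close>.
\<close>

lemma lower_raise1:
  assumes e0: "\<And>m. act (vir_e 0) (u m) = vscale (h + of_nat m) (u m)"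
    and low0: "act (vir_e (- 1)) (u 0) = 0"
    and low: "\<And>m. m < N \<Longrightarrow> act (vir_e (- 1)) (u (Suc m)) = vscale (g (Suc m)) (u m)"
    and step: "\<And>m. m < N \<Longrightarrow>
      a (Suc N) m * (of_nat N + 2 - of_nat m) + a (Suc N) (Suc m) * g (Suc m) = x * a N m"
  shows "act (vir_e (- 1)) (raise a u (Suc N)) =
    vscale x (raise a u N) + vscale (a (Suc N) N * (2 * (h + of_nat N))) (u N)"
proof -
  let ?e = "\<lambda>i. act (vir_e i)"
  \<comment> \<open>\<open>A\<close> collects the terms where \<open>e\<^sub>-\<^sub>1\<close> passes the letter, \<open>B\<close> the commutators. Shifting the
    index of \<open>A\<close> by one makes both carry \<open>e\<^bsub>N-m\<^esub> u\<^sub>m\<close>; the term \<open>B N\<close> with \<open>e\<^sub>0\<close> is left over.\<close>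
  define A where "A m = vscale (a (Suc N) m) (?e (int (Suc N) - int m) (?e (- 1) (u m)))" for m
  define B where "B m = vscale (a (Suc N) m * (of_nat N + 2 - of_nat m)) (?e (int N - int m) (u m))" for m
  have "?e (- 1) (vscale (a (Suc N) m) (?e (int (Suc N) - int m) (u m))) = A m + B m"
    if "m < Suc N" for m
  proof -
    have "?e (- 1) (?e (int (Suc N) - int m) (u m)) =
        ?e (int (Suc N) - int m) (?e (- 1) (u m))
        + vscale (of_nat N + 2 - of_nat m) (?e (int N - int m) (u m))"
      by (subst act_e_e) (auto simp: algebra_simps)
    then show ?thesis
      by (simp add: A_def B_def act_scale_right V.scale_right_distrib)
  qed
  then have "?e (- 1) (raise a u (Suc N)) = (\<Sum>m<Suc N. A m) + (\<Sum>m<Suc N. B m)"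
    unfolding raise_def act_sum_right by (simp add: sum.distrib)
  also have "(\<Sum>m<Suc N. A m) = (\<Sum>m<N. A (Suc m))"
    unfolding sum.lessThan_Suc_shift by (simp add: A_def low0)
  also have "(\<Sum>m<Suc N. B m) = (\<Sum>m<N. B m) + B N" by simp
  also have "(\<Sum>m<N. A (Suc m)) + ((\<Sum>m<N. B m) + B N) = (\<Sum>m<N. B m + A (Suc m)) + B N"
    by (simp add: sum.distrib)
  also have "(\<Sum>m<N. B m + A (Suc m)) = vscale x (raise a u N)"
    unfolding raise_def V.scale_sum_right
    by (rule sum.cong)
       (simp_all add: A_def B_def low act_scale_right flip: step V.scale_left_distrib)
  also have "B N = vscale (a (Suc N) N * (2 * (h + of_nat N))) (u N)"
    by (simp add: B_def e0)
  finally show ?thesis .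
qed

lemma lower_raise2:
  assumes e0: "\<And>m. act (vir_e 0) (u m) = vscale (h + of_nat m) (u m)"
    and z: "\<And>m. act vir_z (u m) = vscale c (u m)"
    and low0: "act (vir_e (- 2)) (u 0) = 0" "act (vir_e (- 2)) (u 1) = 0"
    and low1: "act (vir_e (- 1)) (u (N + 1)) = vscale g1 (u N)"
    and low: "\<And>m. m < N \<Longrightarrow> act (vir_e (- 2)) (u (m + 2)) = vscale (g (m + 2)) (u m)"
    and step: "\<And>m. m < N \<Longrightarrow>
      a (N + 2) m * (of_nat N + 4 - of_nat m) + a (N + 2) (m + 2) * g (m + 2) = x * a N m"
  shows "act (vir_e (- 2)) (raise a u (N + 2)) = vscale x (raise a u N)
    + vscale (a (N + 2) N * (4 * (h + of_nat N) + c / 2) + a (N + 2) (N + 1) * (3 * g1)) (u N)"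
proof -
  let ?e = "\<lambda>i. act (vir_e i)"
  \<comment> \<open>Two commutators are left over after the shift: \<open>B N\<close> with \<open>e\<^sub>0\<close> and the central term,
    and \<open>B (N + 1)\<close> with \<open>e\<^sub>-\<^sub>1\<close>.\<close>
  define A where "A m = vscale (a (N + 2) m) (?e (int (N + 2) - int m) (?e (- 2) (u m)))" for m
  define B where "B m = vscale (a (N + 2) m) (vscale (of_nat N + 4 - of_nat m) (?e (int N - int m) (u m))
      + vscale (if m = N then c / 2 else 0) (u m))" for m
  have "?e (- 2) (vscale (a (N + 2) m) (?e (int (N + 2) - int m) (u m))) = A m + B m"
    if "m < N + 2" for m
  proof -
    have "?e (- 2) (?e (int (N + 2) - int m) (u m)) =
        ?e (int (N + 2) - int m) (?e (- 2) (u m))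
        + (vscale (of_nat N + 4 - of_nat m) (?e (int N - int m) (u m))
           + vscale (if m = N then c / 2 else 0) (u m))"
      by (subst act_e_e) (auto simp: algebra_simps z)
    then show ?thesis
      by (simp add: A_def B_def act_scale_right V.scale_right_distrib)
  qed
  then have "?e (- 2) (raise a u (N + 2)) = (\<Sum>m<N + 2. A m) + (\<Sum>m<N + 2. B m)"
    unfolding raise_def act_sum_right by (simp add: sum.distrib)
  also have "(\<Sum>m<N + 2. A m) = (\<Sum>m<N. A (m + 2))"
    by (simp add: sum.lessThan_Suc_shift A_def low0[simplified] numeral_2_eq_2 del: sum.lessThan_Suc)
  also have "(\<Sum>m<N + 2. B m) = (\<Sum>m<N. B m) + (B N + B (N + 1))"
    by (simp add: numeral_2_eq_2)
  also have "(\<Sum>m<N. A (m + 2)) + ((\<Sum>m<N. B m) + (B N + B (N + 1)))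
      = (\<Sum>m<N. B m + A (m + 2)) + (B N + B (N + 1))"
    by (simp add: sum.distrib)
  also have "(\<Sum>m<N. B m + A (m + 2)) = vscale x (raise a u N)"
    unfolding raise_def V.scale_sum_right
  proof (rule sum.cong)
    fix m assume "m \<in> {..<N}"
    then have m: "m < N" by simp
    have "int (N + 2) - int (m + 2) = int N - int m" by simp
    then show "B m + A (m + 2) = vscale x (vscale (a N m) (?e (int N - int m) (u m)))"
      unfolding A_def B_def low[OF m] using m
      by (simp add: act_scale_right flip: step V.scale_left_distrib)
  qed simp
  also have "B N + B (N + 1) =
      vscale (a (N + 2) N * (4 * (h + of_nat N) + c / 2) + a (N + 2) (N + 1) * (3 * g1)) (u N)"
    by (simp add: B_def e0 low1[simplified] flip: V.scale_left_distrib)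
  finally show ?thesis by simp
qed

section \<open>Level vectors\<close>

definition word :: "nat list \<Rightarrow> 'v" where
  "word ks = foldr act (map (\<lambda>k. vir_e (int k)) ks) v"

lemma act_z_word: "act vir_z (word ks) = vscale c (word ks)"
  by (induction ks) (simp_all add: word_def act_z_v act_z_e act_scale_right)

lemma act_e0_word: "act (vir_e 0) (word ks) = vscale (h + of_nat (sum_list ks)) (word ks)"
proof (induction ks)
  case (Cons k ks)
  have "act (vir_e 0) (word (k # ks)) =
      act (vir_e (int k)) (act (vir_e 0) (word ks)) + vscale (of_nat k) (word (k # ks))"
    by (simp add: word_def act_e_e[of 0 "int k"])
  then show ?case
    unfolding Cons.IH act_scale_right
    by (simp add: word_def algebra_simps flip: V.scale_left_distrib)
qed (simp add: word_def act_e0_v)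

definition level_vector :: "nat \<Rightarrow> complex \<Rightarrow> nat \<Rightarrow> 'v" where
  "level_vector p t n = (\<Sum>ks\<in>weak_compositions n. vscale (weight p t ks) (word ks))"

lemma level_vector_0: "level_vector p t 0 = v"
  by (simp add: level_vector_def weak_compositions_0 word_def)

text \<open>
  Splitting off the first letter of a composition.
\<close>

lemma level_vector_rec:
  assumes "n > 0"
  shows "level_vector p t n = vscale (level_factor p t n) (raise (step_coeff p t) (level_vector p t) n)"
proof -
  have "level_vector p t n = (\<Sum>m<n. \<Sum>ks\<in>weak_compositions m.
      vscale (weight p t ((n - m) # ks)) (word ((n - m) # ks)))"
    unfolding level_vector_def by (rule sum_weak_compositions[OF assms])
  also have "\<dots> = (\<Sum>m<n. vscale (level_factor p t n) (vscale (step_coeff p t n m)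
      (act (vir_e (int n - int m)) (level_vector p t m))))"
  proof (rule sum.cong)
    fix m assume "m \<in> {..<n}"
    then have m: "m < n" by simp
    show "(\<Sum>ks\<in>weak_compositions m. vscale (weight p t ((n - m) # ks)) (word ((n - m) # ks))) =
        vscale (level_factor p t n) (vscale (step_coeff p t n m)
          (act (vir_e (int n - int m)) (level_vector p t m)))"
      unfolding level_vector_def act_sum_right V.scale_sum_right
      by (rule sum.cong)
         (use m in \<open>auto simp: weak_compositions_def word_def act_scale_right of_nat_diff mult_ac\<close>)
  qed simp
  finally show ?thesis by (simp add: raise_def V.scale_sum_right)
qed

lemma act_z_level_vector: "act vir_z (level_vector p t n) = vscale c (level_vector p t n)"
  by (simp add: level_vector_def act_sum_right act_scale_right act_z_word V.scale_sum_right mult.commute)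

lemma act_e0_level_vector:
  "act (vir_e 0) (level_vector p t n) = vscale (h + of_nat n) (level_vector p t n)"
  unfolding level_vector_def act_sum_right V.scale_sum_right
  by (rule sum.cong)
     (auto simp: act_scale_right act_e0_word weak_compositions_def mult.commute)

text \<open>
  The recursion cleared of denominators. At level \<open>0\<close> both sides vanish, so that the relation is
  available at all levels below \<open>2 p\<close>.
\<close>

lemma level_norm_level_vector:
  assumes "t \<noteq> 0" "n < 2 * p"
  shows "vscale (level_norm p t n) (level_vector p t n) = raise (step_coeff p t) (level_vector p t) n"
proof (cases "n = 0")
  case True
  then show ?thesis by (simp add: level_norm_def raise_def)
next
  case False
  have "(of_nat n :: complex) \<noteq> of_nat (2 * p)"
    using assms(2) unfolding of_nat_eq_iff by simp
  then have "level_norm p t n * level_factor p t n = 1"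
    using assms False by (simp add: level_norm_def level_factor_def)
  then show ?thesis using False by (simp add: level_vector_rec[of n])
qed

context
  fixes p :: nat and t :: complex
  assumes t: "t \<noteq> 0"
    and c: "c = 13 + 6 * t + 6 * inverse t"
    and h: "h = - ((of_nat p - 1 + t) * (inverse t * (of_nat p + 1) + 3)) / 4"
begin

definition lower1_coeff :: "nat \<Rightarrow> complex" where
  "lower1_coeff n = (of_nat n - of_nat p - 3 * t - 2) * offset p t n"

definition lower2_coeff :: "nat \<Rightarrow> complex" where
  "lower2_coeff n = (of_nat n - of_nat p - 5 * t - 4) * offset p t n * offset p t (n - 1)"

lemma lower1_raise:
  assumes N: "N < 2 * p"
    and low: "\<And>m. m < N \<Longrightarrow>
      act (vir_e (- 1)) (level_vector p t (Suc m)) = vscale (lower1_coeff (Suc m)) (level_vector p t m)"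
  shows "act (vir_e (- 1)) (raise (step_coeff p t) (level_vector p t) (Suc N)) =
    vscale (lower1_coeff (Suc N) * level_norm p t (Suc N)) (level_vector p t N)"
proof -
  let ?x = "(of_nat N + 2 - of_nat p - 3 * t) * offset p t N"
  have "act (vir_e (- 1)) (raise (step_coeff p t) (level_vector p t) (Suc N)) =
      vscale ?x (raise (step_coeff p t) (level_vector p t) N)
      + vscale (step_coeff p t (Suc N) N * (2 * (h + of_nat N))) (level_vector p t N)"
  proof (rule lower_raise1[where g = lower1_coeff])
    show "act (vir_e (- 1)) (level_vector p t 0) = 0"
      by (simp add: level_vector_0 act_e_neg_v)
  qed (auto simp: act_e0_level_vector low lower1_coeff_def step_lowering_identity1[simplified])
  also have "\<dots> = vscale (?x * level_norm p t N + step_coeff p t (Suc N) N * (2 * (h + of_nat N)))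
      (level_vector p t N)"
    unfolding level_norm_level_vector[OF t N, symmetric]
    by (simp add: V.scale_left_distrib)
  also have "?x * level_norm p t N + step_coeff p t (Suc N) N * (2 * (h + of_nat N)) =
      lower1_coeff (Suc N) * level_norm p t (Suc N)"
    unfolding lower1_coeff_def by (rule scalar_identity1[OF t h])
  finally show ?thesis .
qed

lemma lower2_raise:
  assumes N: "N < 2 * p"
    and low1: "act (vir_e (- 1)) (level_vector p t (N + 1)) = vscale (lower1_coeff (N + 1)) (level_vector p t N)"
    and low0: "act (vir_e (- 2)) (level_vector p t 1) = 0"
    and low: "\<And>m. m < N \<Longrightarrow>
      act (vir_e (- 2)) (level_vector p t (m + 2)) = vscale (lower2_coeff (m + 2)) (level_vector p t m)"
  shows "act (vir_e (- 2)) (raise (step_coeff p t) (level_vector p t) (N + 2)) =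
    vscale (lower2_coeff (N + 2) * level_norm p t (N + 2)) (level_vector p t N)"
proof -
  let ?x = "(of_nat N + 4 - of_nat p - 5 * t) * offset p t N * offset p t (N + 1)"
  let ?y = "step_coeff p t (N + 2) N * (4 * (h + of_nat N) + c / 2)
      + step_coeff p t (N + 2) (N + 1) * (3 * lower1_coeff (N + 1))"
  have step: "step_coeff p t (N + 2) m * (of_nat N + 4 - of_nat m)
     + step_coeff p t (N + 2) (m + 2) * lower2_coeff (m + 2) = ?x * step_coeff p t N m" if "m < N" for m
  proof -
    have "m + 2 - 1 = m + 1" by simp
    then show ?thesis unfolding lower2_coeff_def using step_lowering_identity2[OF that, of p t] by (simp only:)
  qed
  have "act (vir_e (- 2)) (raise (step_coeff p t) (level_vector p t) (N + 2)) =
      vscale ?x (raise (step_coeff p t) (level_vector p t) N) + vscale ?y (level_vector p t N)"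
  proof (rule lower_raise2[where g = lower2_coeff])
    show "act (vir_e (- 2)) (level_vector p t 0) = 0"
      by (simp add: level_vector_0 act_e_neg_v)
  qed (fact act_e0_level_vector act_z_level_vector low low0 low1 step)+
  also have "\<dots> = vscale (?x * level_norm p t N + ?y) (level_vector p t N)"
    unfolding level_norm_level_vector[OF t N, symmetric]
    by (simp add: V.scale_left_distrib)
  also have "?x * level_norm p t N + ?y = lower2_coeff (N + 2) * level_norm p t (N + 2)"
  proof -
    have "N + 2 - 1 = N + 1" by simp
    then show ?thesis
      using scalar_identity2[OF t c h, of N] unfolding lower1_coeff_def lower2_coeff_def by (simp only:)
  qed
  finally show ?thesis .
qed

lemma lower_raise_level1:
  "act (vir_e (- 2)) (raise a (level_vector p t) 1) = 0"
proof -
  have "act (vir_e (- 2)) (act (vir_e 1) v) = 0"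
    by (simp add: act_e_e[of "- 2" 1] act_e_neg_v)
  then show ?thesis by (simp add: raise_def level_vector_0 act_scale_right)
qed

text \<open>
  Passes from a raised vector to the level vector below the top, where the norm is invertible.
\<close>

lemma cancel_level_norm:
  assumes n: "0 < n" "n < 2 * p"
    and "act x (raise (step_coeff p t) (level_vector p t) n) = vscale (b * level_norm p t n) u"
  shows "act x (level_vector p t n) = vscale b u"
proof -
  have "(of_nat n :: complex) \<noteq> of_nat (2 * p)"
    using n(2) unfolding of_nat_eq_iff by simp
  then have "level_norm p t n \<noteq> 0" using n t by (simp add: level_norm_def)
  moreover have "vscale (level_norm p t n) (act x (level_vector p t n)) = vscale (level_norm p t n) (vscale b u)"
    using assms(3) unfolding level_norm_level_vector[OF t n(2), symmetric]
    by (simp add: act_scale_right mult.commute)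
  ultimately show ?thesis by (simp only: V.scale_cancel_left) simp
qed

text \<open>
  Induction on the level: the lowering formula at all smaller levels gives it for the raised
  vector, and the norm cancels.
\<close>

lemma lower1_level_vector:
  "Suc n < 2 * p \<Longrightarrow>
    act (vir_e (- 1)) (level_vector p t (Suc n)) = vscale (lower1_coeff (Suc n)) (level_vector p t n)"
proof (induction n rule: less_induct)
  case (less n)
  then have "act (vir_e (- 1)) (raise (step_coeff p t) (level_vector p t) (Suc n)) =
      vscale (lower1_coeff (Suc n) * level_norm p t (Suc n)) (level_vector p t n)"
    by (intro lower1_raise) simp_all
  with less.prems show ?case by (intro cancel_level_norm) simp_all
qed

lemma lower2_level1: "1 < 2 * p \<Longrightarrow> act (vir_e (- 2)) (level_vector p t 1) = 0"
  using cancel_level_norm[of 1 "vir_e (- 2)" 0] lower_raise_level1 by simp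

lemma lower2_level_vector:
  "n + 2 < 2 * p \<Longrightarrow>
    act (vir_e (- 2)) (level_vector p t (n + 2)) = vscale (lower2_coeff (n + 2)) (level_vector p t n)"
proof (induction n rule: less_induct)
  case (less n)
  show ?case
  proof (rule cancel_level_norm)
    show "act (vir_e (- 2)) (raise (step_coeff p t) (level_vector p t) (n + 2)) =
        vscale (lower2_coeff (n + 2) * level_norm p t (n + 2)) (level_vector p t n)"
      using less lower1_level_vector[of n] by (intro lower2_raise lower2_level1) auto
  qed (use less in auto)
qed

text \<open>
  At level \<open>2 p\<close> the raised vector itself is the level vector, while the lowering formulas for raised
  vectors still carry the norm of that level, which is zero. Since \<open>e\<^sub>-\<^sub>1\<close> and \<open>e\<^sub>-\<^sub>2\<close> generate all
  \<open>e\<^sub>i\<close> with \<open>i < 0\<close>, two formulas suffice.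
\<close>

lemma act_neg_level_2p:
  assumes "p \<ge> 1" "i < 0"
  shows "act (vir_e i) (level_vector p t (2 * p)) = 0"
proof -
  let ?S = "level_vector p t (2 * p)"
  have S: "?S = raise (step_coeff p t) (level_vector p t) (2 * p)"
    using assms(1) by (simp add: level_vector_rec[of "2 * p"] level_factor_def)
  \<comment> \<open>This zero is the reason for singularity.\<close>
  have norm: "level_norm p t (2 * p) = 0" by (simp add: level_norm_def)
  obtain N where N: "2 * p = Suc N"
    using assms(1) by (cases "2 * p") auto
  have "act (vir_e (- 1)) (raise (step_coeff p t) (level_vector p t) (Suc N)) =
      vscale (lower1_coeff (Suc N) * level_norm p t (Suc N)) (level_vector p t N)"
    by (rule lower1_raise) (simp_all add: N lower1_level_vector)
  then have e1: "act (vir_e (- 1)) ?S = 0"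
    unfolding S N[symmetric] norm by simp
  have e2: "act (vir_e (- 2)) ?S = 0"
  proof -
    define M where "M = 2 * p - 2"
    have M: "2 * p = M + 2" "M + 1 < 2 * p" using assms(1) by (simp_all add: M_def)
    have "act (vir_e (- 2)) (raise (step_coeff p t) (level_vector p t) (M + 2)) =
        vscale (lower2_coeff (M + 2) * level_norm p t (M + 2)) (level_vector p t M)"
    proof (rule lower2_raise)
      show "act (vir_e (- 1)) (level_vector p t (M + 1)) = vscale (lower1_coeff (M + 1)) (level_vector p t M)"
        using lower1_level_vector[of M] M(2) by simp
      show "act (vir_e (- 2)) (level_vector p t 1) = 0"
        by (rule lower2_level1) (use M in linarith)
      show "act (vir_e (- 2)) (level_vector p t (m + 2)) = vscale (lower2_coeff (m + 2)) (level_vector p t m)"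
        if "m < M" for m
        by (rule lower2_level_vector) (use M that in linarith)
    qed (use M in linarith)
    then show ?thesis
      unfolding S M(1)[symmetric] norm by simp
  qed
  \<comment> \<open>\<open>[e\<^sub>-\<^sub>1, e\<^bsub>-k\<^esub>]\<close> is a nonzero multiple of \<open>e\<^bsub>-k-1\<^esub>\<close> for \<open>k \<ge> 2\<close>.\<close>
  have "act (vir_e (- int (Suc n))) ?S = 0" for n
  proof (induction n)
    case 0
    show ?case using e1 by simp
  next
    case (Suc n)
    show ?case
    proof (cases "n = 0")
      case True
      then show ?thesis using e2 by simp
    next
      case False
      have idx: "- 1 + - int (Suc n) = - int (Suc (Suc n))" by simp
      have neq: "(- int (Suc n) = - (- 1)) = False" by simp
      have "0 = vscale (of_int (- int (Suc n)) - of_int (- 1)) (act (vir_e (- int (Suc (Suc n)))) ?S)"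
        using act_e_e[of "- 1" "- int (Suc n)" ?S] unfolding idx Suc.IH e1 neq
        by (simp only: act_zero_right if_False V.scale_zero_left add_0_left add_0_right)
      moreover have "(of_int (- int (Suc n)) - of_int (- 1) :: complex) \<noteq> 0" using False by simp
      ultimately show ?thesis by (metis V.scale_eq_0_iff)
    qed
  qed
  from this[of "nat (- i) - 1"] show ?thesis using assms(2) by simp
qed

end

end

section \<open>A character of the positive part\<close>

lemma keys_L1:
  assumes "x \<in> L1"
  shows "Poly_Mapping.keys x \<subseteq> E ` {1..}"
proof -
  have "vir.span {vir_e i | i. i \<ge> 1} \<subseteq> {x. Poly_Mapping.keys x \<subseteq> E ` {1..}}"
  proof (rule vir.span_minimal)
    show "vir.subspace {x. Poly_Mapping.keys x \<subseteq> E ` {1..}}"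
      unfolding vir.subspace_def
    proof (intro conjI ballI allI)
      fix x y :: vir assume "x \<in> {x. Poly_Mapping.keys x \<subseteq> E ` {1..}}" "y \<in> {x. Poly_Mapping.keys x \<subseteq> E ` {1..}}"
      then show "x + y \<in> {x. Poly_Mapping.keys x \<subseteq> E ` {1..}}"
        using Poly_Mapping.keys_add[of x y] by blast
    next
      fix x :: vir and a assume "x \<in> {x. Poly_Mapping.keys x \<subseteq> E ` {1..}}"
      then show "vir_scale a x \<in> {x. Poly_Mapping.keys x \<subseteq> E ` {1..}}"
        using keys_vir_scale[of a x] by blast
    qed simp
  qed (auto simp: vir_e_def)
  with assms show ?thesis by (auto simp: L1_def)
qed

text \<open>
  Commutators of elements of \<open>L\<^sub>1\<close> have degree at least \<open>3\<close>, so that \<open>e\<^sub>1\<close> can be detected by a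
  character of \<open>L\<^sub>1\<close>.
\<close>

lemma lookup_bracket_L1:
  assumes "x \<in> L1" "y \<in> L1"
  shows "Poly_Mapping.lookup (vir_bracket x y) (E 1) = 0"
proof -
  have "Poly_Mapping.lookup (vir_basis_bracket a b) (E 1) = 0"
    if ab: "a \<in> Poly_Mapping.keys x" "b \<in> Poly_Mapping.keys y" for a b
  proof -
    obtain i j where "a = E i" "b = E j" "i \<ge> 1" "j \<ge> 1"
      using ab keys_L1[OF assms(1)] keys_L1[OF assms(2)] by blast
    then show ?thesis by (auto simp: vir_e_def lookup_add lookup_single when_def)
  qed
  then show ?thesis by (simp add: vir_bracket_def lookup_sum)
qed

text \<open>
  The one-dimensional module of \<open>L\<^sub>1\<close> on which \<open>e\<^sub>1\<close> is the identity and every other \<open>e\<^sub>k\<close> is zero does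
  not extend to the Virasoro algebra. Modules are over a Lie algebra on a whole type, hence the
  bracket is modified outside \<open>L\<^sub>1\<close>; the enveloping algebra of \<open>L\<^sub>1\<close> only sees its values on \<open>L\<^sub>1\<close>.
\<close>

lemma exists_L1_character_module:
  obtains bracket' act where "lie_module vir_scale bracket' (*) act"
    and "lie_algebra.lie_subalgebra vir_scale bracket' L1"
    and "uea_ideal vir_scale bracket' L1 = uea_ideal vir_scale vir_bracket L1"
    and "\<And>k u. k \<ge> 1 \<Longrightarrow> act (vir_e k) u = (if k = 1 then u else 0)"
proof -
  interpret VV: vector_space_pair vir_scale vir_scale by unfold_locales
  have L1: "vir.subspace L1" using lie_subalgebra_L1 by (simp add: vir.lie_subalgebra_def)
  \<comment> \<open>A linear projection onto \<open>L\<^sub>1\<close>. Precomposing the bracket with it keeps the Jacobi identity,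
    because all brackets already lie in \<open>L\<^sub>1\<close>.\<close>
  obtain \<pi> where \<pi>: "range \<pi> \<subseteq> L1" "Vector_Spaces.linear vir_scale vir_scale \<pi>"
    "\<And>x. x \<in> L1 \<Longrightarrow> \<pi> x = x"
    using VV.linear_exists_left_inverse_on[OF vir.linear_id L1] by auto
  interpret \<pi>: Vector_Spaces.linear vir_scale vir_scale \<pi> by (rule \<pi>(2))
  have \<pi>_L1: "\<pi> x \<in> L1" for x using \<pi>(1) by blast
  define bracket' where "bracket' x y = vir_bracket (\<pi> x) (\<pi> y)" for x y
  define act where "act x u = Poly_Mapping.lookup (\<pi> x) (E 1) * u" for x u
  have bracket'_L1: "bracket' x y \<in> L1" for x y
    using lie_subalgebra_L1 \<pi>_L1 by (simp add: bracket'_def vir.lie_subalgebra_def)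
  have \<pi>_bracket': "\<pi> (bracket' x y) = bracket' x y" for x y
    by (rule \<pi>(3)[OF bracket'_L1])
  interpret L: lie_algebra vir_scale bracket'
  proof
    fix x y w a
    show "bracket' x (bracket' y w) + bracket' y (bracket' w x) + bracket' w (bracket' x y) = 0"
      using vir_jacobi[of "\<pi> x" "\<pi> y" "\<pi> w"] \<pi>_bracket'[unfolded bracket'_def] by (simp add: bracket'_def)
  qed (simp_all add: bracket'_def \<pi>.add \<pi>.scale vir.bracket_add_left vir.bracket_add_right
      vir.bracket_scale_left vir.bracket_scale_right vir.bracket_self)
  interpret M: lie_module vir_scale bracket' "(*) :: complex \<Rightarrow> complex \<Rightarrow> complex" act
  proof
    fix x y u
    have "Poly_Mapping.lookup (bracket' x y) (E 1) = 0"
      unfolding bracket'_def by (rule lookup_bracket_L1[OF \<pi>_L1 \<pi>_L1])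
    then show "act (bracket' x y) u = act x (act y u) - act y (act x u)"
      by (simp add: act_def \<pi>_bracket')
  qed (simp_all add: act_def \<pi>.add \<pi>.scale lookup_add algebra_simps)
  have eq: "bracket' x y = vir_bracket x y" if "x \<in> L1" "y \<in> L1" for x y
    using that by (simp add: bracket'_def \<pi>(3))
  show ?thesis
  proof (rule that)
    show "lie_module vir_scale bracket' (*) act" by (rule M.lie_module_axioms)
    show "L.lie_subalgebra L1"
      using L1 bracket'_L1 by (simp add: L.lie_subalgebra_def)
    have "uea_relations vir_scale bracket' L1 = uea_relations vir_scale vir_bracket L1"
      unfolding uea_relations_def by (intro arg_cong2[where f = "(\<union>)"] refl Collect_cong) (metis eq)
    then show "uea_ideal vir_scale bracket' L1 = uea_ideal vir_scale vir_bracket L1"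
      by (simp add: uea_ideal_def)
    show "act (vir_e k) u = (if k = 1 then u else 0)" if "k \<ge> 1" for k u
      using \<pi>(3)[OF vir_e_in_L1[OF that]] by (simp add: act_def) (simp add: vir_e_def lookup_single when_def)
  qed
qed

text \<open>
  Elements of the ideal act by zero on the one-dimensional module, while a word acts by \<open>1\<close> if it
  is a power of \<open>e\<^sub>1\<close> and by \<open>0\<close> otherwise.
\<close>

lemma e1_power_coefficient_zero:
  assumes fin: "finite A" and pos: "\<And>ks. ks \<in> A \<Longrightarrow> 0 \<notin> set ks"
    and "(\<Sum>ks\<in>A. Poly_Mapping.single (FM (map (\<lambda>k. vir_e (int k)) ks)) (f ks))
      \<in> uea_ideal vir_scale vir_bracket L1"
  shows "(\<Sum>ks\<in>{ks \<in> A. set ks \<subseteq> {1}}. f ks) = 0"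
proof -
  obtain bracket' act where M: "lie_module vir_scale bracket' (*) act"
    and sub: "lie_algebra.lie_subalgebra vir_scale bracket' L1"
    and ideal: "uea_ideal vir_scale bracket' L1 = uea_ideal vir_scale vir_bracket L1"
    and act: "\<And>k u. k \<ge> 1 \<Longrightarrow> act (vir_e k) u = (if k = 1 then u else 0)"
    by (rule exists_L1_character_module) blast
  interpret M: lie_module vir_scale bracket' "(*) :: complex \<Rightarrow> complex \<Rightarrow> complex" act by (rule M)
  have word: "foldr act (map (\<lambda>k. vir_e (int k)) ks) 1 = (if set ks \<subseteq> {1} then 1 else 0)"
    if "0 \<notin> set ks" for ks
    using that by (induction ks) (auto simp: act)
  have "0 = free_act (*) act (\<Sum>ks\<in>A. Poly_Mapping.single (FM (map (\<lambda>k. vir_e (int k)) ks)) (f ks)) 1"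
    using M.free_act_uea_ideal[OF sub] assms(3) by (simp add: ideal)
  also have "\<dots> = (\<Sum>ks\<in>A. f ks * (if set ks \<subseteq> {1} then 1 else 0))"
    unfolding M.free_act_sum M.free_act_single using word pos by (intro sum.cong) auto
  also have "\<dots> = (\<Sum>ks\<in>{ks \<in> A. set ks \<subseteq> {1}}. f ks)"
    using fin by (simp add: sum.inter_filter if_distrib cong: if_cong)
  finally show ?thesis by simp
qed

section \<open>The singular vector\<close>

theorem theorem1p5:
  fixes p :: nat and t c h :: complex
    and vscale :: "complex \<Rightarrow> 'v::ab_group_add \<Rightarrow> 'v"
    and act :: "vir \<Rightarrow> 'v \<Rightarrow> 'v" and v :: 'v
  assumes "p \<ge> 1" and "t \<noteq> 0"
    and "c = 13 + 6 * t + 6 * inverse t"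
    and "h = - ((of_nat p - 1 + t) * (inverse t * (of_nat p + 1) + 3)) / 4"
    and "verma_module h c vscale act v"
  shows "singular_vector act (uea_act vscale act (S_2p p t) v)"
proof -
  from assms(5) interpret highest_weight_module vscale act h c v
    unfolding verma_module_def highest_weight_module_def highest_weight_module_axioms_def by blast
  have inj: "inj_on (\<lambda>u. uea_act vscale act u v) (carrier (uea vir_scale vir_bracket L1))"
    using assms(5) by (auto simp: verma_module_def bij_betw_def)
  let ?q = "\<Sum>ks\<in>compositions (2 * p).
    Poly_Mapping.single (FM (map (\<lambda>k. vir_e (int k)) ks)) (rat_value (f_coeff p rat_var ks) t)"
  have fin: "finite (compositions (2 * p))"
    using finite_weak_compositions[of "2 * p"] assms(1) by (simp add: weak_compositions_eq)
  have pos: "0 \<notin> set ks" if "ks \<in> compositions (2 * p)" for ks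
    using that by (auto simp: compositions_def)
  obtain b where b: "\<And>ks. ks \<in> compositions (2 * p) \<Longrightarrow>
      rat_value (f_coeff p rat_var ks) t = b * weight p t ks"
    using rat_value_f_coeff[OF assms(1,2)] by blast
  have Sv: "uea_act vscale act (S_2p p t) v = vscale b (level_vector p t (2 * p))"
  proof -
    have "uea_act vscale act (S_2p p t) v = free_act vscale act ?q v"
      unfolding S_2p_def by (rule uea_act_class[OF lie_subalgebra_L1])
    also have "\<dots> = (\<Sum>ks\<in>compositions (2 * p). vscale b (vscale (weight p t ks) (word ks)))"
      unfolding free_act_sum free_act_single by (rule sum.cong) (simp_all add: b word_def)
    also have "\<dots> = vscale b (level_vector p t (2 * p))"
      using assms(1) by (simp add: level_vector_def weak_compositions_eq V.scale_sum_right)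
    finally show ?thesis .
  qed
  \<comment> \<open>If the vector were zero, injectivity of \<open>u \<mapsto> u v\<close> would put the representative into the
    ideal of relations, against the coefficient \<open>1\<close> of \<open>e\<^sub>1\<^bsup>2p\<^esup>\<close>.\<close>
  have "uea_act vscale act (S_2p p t) v \<noteq> 0"
  proof
    interpret F: ring "free_algebra L1" by (rule ring_free_algebra)
    interpret I: ideal "uea_ideal vir_scale vir_bracket L1" "free_algebra L1"
      by (rule uea_ideal_ideal[OF lie_subalgebra_L1])
    assume "uea_act vscale act (S_2p p t) v = 0"
    moreover have "uea_act vscale act (uea_class vir_scale vir_bracket L1 0) v = 0"
      by (simp add: uea_act_class[OF lie_subalgebra_L1])
    moreover have q: "?q \<in> carrier (free_algebra L1)"
    proof -
      have "Poly_Mapping.keys ?q \<subseteq> (\<Union>ks\<in>compositions (2 * p).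
          Poly_Mapping.keys (Poly_Mapping.single (FM (map (\<lambda>k. vir_e (int k)) ks))
            (rat_value (f_coeff p rat_var ks) t)))"
        by (rule keys_sum)
      then show ?thesis
        by (fastforce simp: carrier_free_algebra compositions_def intro!: vir_e_in_L1 split: if_splits)
    qed
    then have "S_2p p t \<in> carrier (uea vir_scale vir_bracket L1)"
      unfolding S_2p_def by (rule uea_class_closed[OF lie_subalgebra_L1])
    moreover have "uea_class vir_scale vir_bracket L1 0 \<in> carrier (uea vir_scale vir_bracket L1)"
      by (rule uea_class_closed[OF lie_subalgebra_L1]) (simp add: carrier_free_algebra)
    ultimately have "S_2p p t = uea_class vir_scale vir_bracket L1 0"
      by (intro inj_onD[OF inj]) simp_all
    also have "\<dots> = uea_ideal vir_scale vir_bracket L1"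
      by (auto simp: uea_class_def a_r_coset_def')
    finally have "?q \<in> uea_ideal vir_scale vir_bracket L1"
      using I.a_rcos_self[OF q] by (simp add: S_2p_def uea_class_def)
    from e1_power_coefficient_zero[OF fin pos this]
    have "(\<Sum>ks\<in>{ks \<in> compositions (2 * p). set ks \<subseteq> {1}}. rat_value (f_coeff p rat_var ks) t) = 0" .
    moreover have "{ks \<in> compositions (2 * p). set ks \<subseteq> {1}} = {replicate (2 * p) 1}"
    proof -
      have "ks = replicate (2 * p) 1" if "set ks \<subseteq> {1}" "sum_list ks = 2 * p" for ks :: "nat list"
      proof -
        have "ks = replicate (length ks) 1"
          using that(1) by (intro replicate_length_same[symmetric]) auto
        moreover from this have "length ks = 2 * p"
          using that(2) sum_list_replicate[of "length ks" "1::nat"] by simp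
        ultimately show ?thesis by simp
      qed
      then show ?thesis using assms(1) by (auto simp: compositions_def sum_list_replicate)
    qed
    ultimately show False using rat_value_f_coeff_ones[OF assms(1,2)] by simp
  qed
  moreover have "act (vir_e i) (uea_act vscale act (S_2p p t) v) = 0" if "i < 0" for i
    unfolding Sv act_scale_right act_neg_level_2p[OF assms(2-4,1) that] by simp
  ultimately show ?thesis by (simp add: singular_vector_def)
qed

end
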